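(* Let $p$ and $q$ be fixed integers such that $0 < p/q < 1$ and $\gcd(p,q)=1$. Then, as $n\to\infty$, with $k = \lfloor \frac{p}{q} n \rfloor$, the spectral gap of a single card in the overlapping-cycles shuffle with parameters $n$ and $k$ satisfies $$\mathrm{gap}(n,k) = (1+o(1))\,\frac{\pi^2 p q}{2 n^2}\times\begin{cases}1, & \text{if } p\equiv q \bmod 2,\\ 4, & \text{if } p\not\equiv q \bmod 2.\end{cases}$$ Here $o(1)$ denotes a quantity tending to $0$ as $n\to\infty$ ($p,q$ being fixed).
   Context: Let $n$ and $k$ be integers with $1\le k<n$. The overlapping-cycles shuffle with parameters $n,k$ acts on a deck of $n$ cards: at each step a fair coin is flipped to decide whether to move the card in position $n$ or the card in position $n-k$ to the top of the deck (position $1$). The position of a single card is a Markov chain on $\{1,\dots,n\}$ with the following transitions: from $i\in[1,n-k-1]$ to $i+1$ with probability $1$; from $n-k$ to $1$ or to $n-k+1$, each with probability $1/2$; from $i\in[n-k+1,n-1]$ to $i$ or to $i+1$, each with probability $1/2$; from $n$ to $1$ or to $n$, each with probability $1/2$. $\mathrm{gap}(n,k)$ denotes the spectral gap of this single-card chain, i.e. $1-\max|\lambda|$, where the maximum is over the $n$ eigenvalues of its transition matrix (counted with algebraic multiplicity) after removing one copy of the eigenvalue $1$. *)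

theory Defs
  imports
    "Jordan_Normal_Form.Char_Poly"
    "HOL-Computational_Algebra.Fundamental_Theorem_Algebra"
    "HOL-Library.Landau_Symbols"
    "HOL-Number_Theory.Cong"
begin

text \<open>Probability that a card in position \<open>i\<close> is in position \<open>j\<close> after one step
  (positions are \<open>1, \<dots>, n\<close>). Meaningful for \<open>1 \<le> k < n\<close> only.\<close>

definition single_card_prob :: "nat \<Rightarrow> nat \<Rightarrow> nat \<Rightarrow> nat \<Rightarrow> real" where
  "single_card_prob n k i j =
     (if i < n - k then (if j = i + 1 then 1 else 0)
      else if i = n - k then (if j = 1 \<or> j = n - k + 1 then 1/2 else 0)
      else if i < n then (if j = i \<or> j = i + 1 then 1/2 else 0)
      else (if j = 1 \<or> j = n then 1/2 else 0))"

text \<open>Matrix indices start at 0, hence the shift. The entries are complex because the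
  eigenvalues are in general not real.\<close>

definition single_card_matrix :: "nat \<Rightarrow> nat \<Rightarrow> complex mat" where
  "single_card_matrix n k =
     mat n n (\<lambda>(i, j). complex_of_real (single_card_prob n k (i + 1) (j + 1)))"

text \<open>The multiset of roots of the characteristic polynomial counts each eigenvalue with its
  algebraic multiplicity; multiset difference then removes a single copy of 1.\<close>

definition spectral_gap :: "nat \<Rightarrow> nat \<Rightarrow> real" where
  "spectral_gap n k =
     1 - Max (cmod ` set_mset (proots (char_poly (single_card_matrix n k)) - {#1#}))"

text \<open>The remaining facts are consistency checks. First, the transition probabilities are those
  induced by the shuffle: position of a card after the card in position \<open>m\<close> is moved to the top.\<close>

definition move_to_top :: "nat \<Rightarrow> nat \<Rightarrow> nat" where
  "move_to_top m i = (if i < m then i + 1 else if i = m then 1 else i)"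

lemma single_card_prob_shuffle:
  assumes "1 \<le> k" "k < n" "i \<in> {1..n}"
  shows "single_card_prob n k i j =
           (of_bool (move_to_top n i = j) + of_bool (move_to_top (n - k) i = j)) / 2"
  using assms by (auto simp: single_card_prob_def move_to_top_def)

lemma single_card_prob_row_sum:
  assumes "1 \<le> k" "k < n" "i \<in> {1..n}"
  shows "(\<Sum>j = 1..n. single_card_prob n k i j) = 1"
proof -
  have m: "move_to_top n i \<in> {1..n}" "move_to_top (n - k) i \<in> {1..n}"
    using assms by (auto simp: move_to_top_def)
  have s: "(\<Sum>j = 1..n. of_bool (a = j) :: real) = 1" if "a \<in> {1..n}" for a
    using that by (simp add: of_bool_def sum.delta)
  have "(\<Sum>j = 1..n. single_card_prob n k i j) =
     ((\<Sum>j = 1..n. of_bool (move_to_top n i = j)) +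
      (\<Sum>j = 1..n. of_bool (move_to_top (n - k) i = j))) / 2"
    by (simp only: single_card_prob_shuffle[OF assms] sum.distrib flip: sum_divide_distrib)
  then show ?thesis unfolding s[OF m(1)] s[OF m(2)] by simp
qed

lemma size_eigenvalues_single_card:
  "size (proots (char_poly (single_card_matrix n k))) = n"
proof -
  have "single_card_matrix n k \<in> carrier_mat n n"
    by (simp add: single_card_matrix_def)
  then show ?thesis
    using degree_monic_char_poly size_proots_complex by metis
qed

lemma one_eigenvalue_single_card:
  assumes "1 \<le> k" "k < n"
  shows "1 \<in># proots (char_poly (single_card_matrix n k))"
proof -
  let ?A = "single_card_matrix n k"
  let ?v = "vec n (\<lambda>_. 1 :: complex)"
  have A: "?A \<in> carrier_mat n n"
    by (simp add: single_card_matrix_def)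
  have "?A *\<^sub>v ?v = 1 \<cdot>\<^sub>v ?v"
  proof (rule eq_vecI)
    fix i assume "i < dim_vec (1 \<cdot>\<^sub>v ?v)"
    then have i: "i < n" by simp
    have "(\<Sum>j = 0..<n. single_card_prob n k (i + 1) (j + 1)) =
          (\<Sum>j = 1..n. single_card_prob n k (i + 1) j)"
      by (rule sum.reindex_bij_witness[of _ "\<lambda>j. j - 1" "\<lambda>j. j + 1"]) auto
    also have "\<dots> = 1"
      using i assms by (intro single_card_prob_row_sum) auto
    finally have "(\<Sum>j = 0..<n. complex_of_real (single_card_prob n k (i + 1) (j + 1))) = 1"
      by (simp only: flip: of_real_sum) simp
    then show "(?A *\<^sub>v ?v) $ i = (1 \<cdot>\<^sub>v ?v) $ i"
      using i by (simp add: single_card_matrix_def scalar_prod_def)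
  qed (simp add: single_card_matrix_def)
  moreover have "?v \<noteq> 0\<^sub>v n"
  proof
    assume "?v = 0\<^sub>v n"
    then have "?v $ 0 = 0\<^sub>v n $ 0" by simp
    then show False using assms by simp
  qed
  ultimately have "eigenvalue ?A 1"
    using A unfolding eigenvalue_def eigenvector_def by (intro exI[of _ ?v]) auto
  then have root: "poly (char_poly ?A) 1 = 0"
    using eigenvalue_root_char_poly[OF A] by simp
  have "char_poly ?A \<noteq> 0"
    using degree_monic_char_poly[OF A] by auto
  then show ?thesis using root by simp
qed

end

theory Submission
  imports Defs "HOL-Analysis.Brouwer_Fixpoint" "HOL-Analysis.Complex_Transcendental"
begin

text \<open>
  With \<open>m = n - k\<close>, the eigenvalues of the chain are the roots of
  \<open>(2 * x - 1) ^ k * (2 * x ^ m - 1) = 1\<close>, and 1 is a simple one. Put \<open>x = exp (w / n)\<close> and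
  \<open>L z = Ln (2 * exp z - 1) = 2 * z - z\<^sup>2 + O(z\<^sup>3)\<close>. As \<open>n\<close> grows the equation in \<open>w\<close> tends to one
  whose purely imaginary solutions are \<open>\<i> * pi * q * t\<close> with \<open>(q - p) * t\<close> even. Near such a point it
  reads \<open>2 * u + k * (L (w / n) - 2 * w / n) + (L y - 2 * y) = 0\<close>, where \<open>u = w - \<i> * pi * q * t\<close> and
  \<open>y = O(u + 1 / n)\<close>. A fixed-point argument produces a root, and the second-order term of \<open>L\<close> gives
  \<open>n * u \<longlonglongrightarrow> - pi\<^sup>2 * p * q * t\<^sup>2 / 2\<close>, so \<open>1 - norm x\<close> is asymptotically
  \<open>pi\<^sup>2 * p * q * t\<^sup>2 / (2 * n\<^sup>2)\<close>. Conversely, if \<open>1 - norm x = O(1 / n\<^sup>2)\<close> then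
  \<open>norm (2 * x - 1) ^ 2 = 2 * norm (x - 1) ^ 2 + 2 * norm x ^ 2 - 1\<close> forces \<open>x - 1 = O(1 / n)\<close>; hence
  \<open>w\<close> is bounded and by compactness accumulates at one of these points, and \<open>t = 0\<close> only occurs
  for \<open>x = 1\<close>. The smallest admissible nonzero \<open>\<bar>t\<bar>\<close> is 1 or 2 according to the parity of \<open>q - p\<close>.
\<close>

subsection \<open>The characteristic polynomial\<close>

abbreviation char_eqn :: "nat \<Rightarrow> nat \<Rightarrow> complex \<Rightarrow> bool" where
  "char_eqn k m x \<equiv> (2 * x - 1) ^ k * (2 * x ^ m - 1) = 1"

text \<open>This solves the eigenvector equation for \<open>x\<close> row by row, starting from
  entry 1 at index 0. Rows before \<open>m - 1\<close> multiply by \<open>x\<close>, row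
  \<open>m - 1\<close> yields \<open>2 * x ^ m - 1\<close>, and later rows multiply by
  \<open>2 * x - 1\<close>.\<close>

definition formal_eigenvector :: "nat \<Rightarrow> complex \<Rightarrow> nat \<Rightarrow> complex" where
  "formal_eigenvector m x i =
     (if i < m then x ^ i else (2 * x - 1) ^ (i - m) * (2 * x ^ m - 1))"

text \<open>All rows but the last are steps of the recursion that produced the vector. The last row
  closes the cycle, and its residual is half the defect in the characteristic equation.\<close>

lemma formal_eigenvector_residual:
  assumes "1 \<le> k" "k < n" "i < n"
  shows "(\<Sum>j<n. ((if i = j then x else 0) - of_real (single_card_prob n k (i + 1) (j + 1)))
            * formal_eigenvector (n - k) x j) =
         (if i = n - 1 then ((2 * x - 1) ^ k * (2 * x ^ (n - k) - 1) - 1) / 2 else 0)"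
proof -
  let ?v = "formal_eigenvector (n - k) x"
  let ?a = "move_to_top n (i + 1) - 1" and ?b = "move_to_top (n - k) (i + 1) - 1"
  have ab: "?a < n" "?b < n" "move_to_top n (i + 1) \<ge> 1" "move_to_top (n - k) (i + 1) \<ge> 1"
    using assms by (auto simp: move_to_top_def)
  \<comment> \<open>Each row is the average of two indicators, one per choice of moved card. For
    \<open>i + 1 < n - k\<close> the two targets coincide and the halves add up to 1.\<close>
  have P: "complex_of_real (single_card_prob n k (i + 1) (j + 1)) =
      ((if j = ?a then 1 else 0) + (if j = ?b then 1 else 0)) / 2" for j
  proof -
    have "(move_to_top n (i + 1) = j + 1) = (j = ?a)" "(move_to_top (n - k) (i + 1) = j + 1) = (j = ?b)"
      using ab by linarith+
    then have "single_card_prob n k (i + 1) (j + 1) = (of_bool (j = ?a) + of_bool (j = ?b)) / 2"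
      using single_card_prob_shuffle[of k n "i + 1" "j + 1"] assms by simp
    then show ?thesis by (auto simp only: of_bool_def split: if_splits) auto
  qed
  have "(\<Sum>j<n. ((if i = j then x else 0) - of_real (single_card_prob n k (i + 1) (j + 1))) * ?v j)
      = (\<Sum>j<n. (if j = i then x * ?v j else 0) - (if j = ?a then ?v j / 2 else 0)
          - (if j = ?b then ?v j / 2 else 0))"
    unfolding P by (intro sum.cong refl) (auto simp: field_simps)
  also have "\<dots> = x * ?v i - ?v ?a / 2 - ?v ?b / 2"
    using ab assms by (simp add: sum_subtractf)
  finally have *: "(\<Sum>j<n. ((if i = j then x else 0) - of_real (single_card_prob n k (i + 1) (j + 1))) * ?v j)
      = x * ?v i - ?v ?a / 2 - ?v ?b / 2" .
  consider "i + 1 < n - k" | "i + 1 = n - k" | "n - k < i + 1" "i + 1 < n" | "i + 1 = n"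
    using assms by linarith
  then show ?thesis
  proof cases
    case 1
    then show ?thesis unfolding *
      by (auto simp: move_to_top_def formal_eigenvector_def)
  next
    case 2
    then have "n - k = Suc i" "i < n - 1" using assms by auto
    then show ?thesis unfolding *
      by (auto simp: move_to_top_def formal_eigenvector_def field_simps)
  next
    case 3
    then have "Suc i - (n - k) = Suc (i - (n - k))" by auto
    with 3 show ?thesis unfolding *
      by (auto simp: move_to_top_def formal_eigenvector_def field_simps)
  next
    case 4
    define E where "E = (2 * x - 1) ^ (i - (n - k))"
    have "k = Suc (i - (n - k))" using 4 assms by auto
    then have k: "(2 * x - 1) ^ k = (2 * x - 1) * E"
      unfolding E_def by (metis power_Suc)
    have v: "?v i = E * (2 * x ^ (n - k) - 1)" "?v ?a = 1" "?b = i"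
      using 4 assms by (auto simp: formal_eigenvector_def move_to_top_def E_def)
    have i: "i = n - 1" using 4 by simp
    show ?thesis
      unfolding * k v using i by (simp add: field_simps)
  qed
qed

text \<open>Multiplying \<open>xI - A\<close> by the unitriangular matrix whose first column is the formal eigenvector
  clears the first column up to its last entry; the complementary minor is lower triangular.\<close>

lemma char_poly_single_card:
  assumes "1 \<le> k" "k < n"
  obtains c :: complex where "c \<noteq> 0"
    and "\<And>x. poly (char_poly (single_card_matrix n k)) x =
           c * ((2 * x - 1) ^ k * (2 * x ^ (n - k) - 1) - 1)"
proof -
  obtain l where n: "n = Suc l" using assms by (cases n) auto
  \<comment> \<open>These are the superdiagonal entries of \<open>M\<close> below, each equal to -1
    or -1/2, so the product is nonzero.\<close>
  define d where "d = (\<Prod>i = 0..<l. - complex_of_real (single_card_prob n k (i + 1) (i + 2)))"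
  define c where "c = (-1) ^ l * d / 2"
  have "c \<noteq> 0"
    using assms by (auto simp: c_def d_def single_card_prob_def n)
  have "poly (char_poly (single_card_matrix n k)) x =
           c * ((2 * x - 1) ^ k * (2 * x ^ (n - k) - 1) - 1)" for x
  proof -
    define M where "M = Matrix.mat n n (\<lambda>(i, j). (if i = j then x else 0) -
        complex_of_real (single_card_prob n k (i + 1) (j + 1)))"
    define U where "U = Matrix.mat n n (\<lambda>(i, j). if j = 0 then formal_eigenvector (n - k) x i
        else if i = j then 1 else 0)"
    define B where "B = M * U"
    have carr: "M \<in> carrier_mat n n" "U \<in> carrier_mat n n" "B \<in> carrier_mat n n"
      by (auto simp: M_def U_def B_def)
    have "poly (char_poly (single_card_matrix n k)) x = det M"
      unfolding char_poly_def
      by (rule poly_det_cong[of _ n])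
        (auto simp: char_poly_matrix_def M_def single_card_matrix_def)
    also have "\<dots> = det B"
    proof -
      have "det U = prod_list (diag_mat U)"
        by (rule det_lower_triangular[OF _ carr(2)]) (auto simp: U_def)
      also have "\<dots> = (\<Prod>i = 0..<n. U $$ (i, i))"
        using carr by (simp add: prod_list_diag_prod)
      also have "\<dots> = 1"
        using assms by (intro prod.neutral) (auto simp: U_def formal_eigenvector_def)
      finally show ?thesis
        using det_mult[OF carr(1,2)] by (simp add: B_def)
    qed
    also have "\<dots> = (\<Sum>i<n. B $$ (i, 0) * cofactor B i 0)"
      using carr(3) assms by (intro laplace_expansion_column) auto
    also have "\<dots> = (\<Sum>i<n. if i = l then
        ((2 * x - 1) ^ k * (2 * x ^ (n - k) - 1) - 1) / 2 * cofactor B i 0 else 0)"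
    proof (intro sum.cong refl)
      fix i assume "i \<in> {..<n}"
      then have "B $$ (i, 0) = (\<Sum>j<n. M $$ (i, j) * U $$ (j, 0))"
        using carr assms by (auto simp: B_def scalar_prod_def lessThan_atLeast0)
      also have "\<dots> = (\<Sum>j<n. ((if i = j then x else 0) -
          of_real (single_card_prob n k (i + 1) (j + 1))) * formal_eigenvector (n - k) x j)"
        using \<open>i \<in> _\<close> assms by (intro sum.cong) (auto simp: M_def U_def)
      finally show "B $$ (i, 0) * cofactor B i 0 = (if i = l then
          ((2 * x - 1) ^ k * (2 * x ^ (n - k) - 1) - 1) / 2 * cofactor B i 0 else 0)"
        using \<open>i \<in> _\<close> formal_eigenvector_residual[OF assms] n by auto
    qed
    also have "\<dots> = ((2 * x - 1) ^ k * (2 * x ^ (n - k) - 1) - 1) / 2 * cofactor B l 0"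
      using n by (simp add: sum.delta)
    also have "cofactor B l 0 = (-1) ^ l * d"
    proof -
      let ?D = "mat_delete B l 0"
      have D: "?D \<in> carrier_mat l l"
        using mat_delete_carrier[OF carr(3)] n by auto
      \<comment> \<open>Multiplying by \<open>U\<close> on the right changes only column 0, which
        the minor deletes.\<close>
      have ent: "?D $$ (i, j) = M $$ (i, j + 1)" if "i < l" "j < l" for i j
      proof -
        have "?D $$ (i, j) = B $$ (i, j + 1)"
          using that carr n by (auto simp: mat_delete_def)
        also have "\<dots> = (\<Sum>h<n. M $$ (i, h) * U $$ (h, j + 1))"
          using that carr n by (auto simp: B_def scalar_prod_def lessThan_atLeast0)
        also have "\<dots> = (\<Sum>h<n. if h = j + 1 then M $$ (i, h) else 0)"
          using that n by (intro sum.cong) (auto simp: U_def)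
        finally show ?thesis using that n by simp
      qed
      \<comment> \<open>Deleting column 0 shifts the superdiagonal onto the diagonal. The entries to
        its right vanish because a card descends by at most one position per step.\<close>
      have "det ?D = prod_list (diag_mat ?D)"
        by (rule det_lower_triangular[OF _ D])
          (use n in \<open>auto simp: ent M_def single_card_prob_def\<close>)
      also have "\<dots> = (\<Prod>i = 0..<l. M $$ (i, i + 1))"
        using D ent by (auto simp: prod_list_diag_prod intro!: prod.cong)
      also have "\<dots> = d"
        unfolding d_def using n by (intro prod.cong) (auto simp: M_def)
      finally show ?thesis by (simp add: cofactor_def)
    qed
    finally show ?thesis by (simp add: c_def)
  qed
  with \<open>c \<noteq> 0\<close> show thesis by (rule that)
qed

text \<open>Discarding one copy of 1 discards the value 1 altogether, because it is a simple root:
  the derivative there is a nonzero multiple of \<open>2 * n\<close>.\<close>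

lemma nonunit_eigenvalues_single_card:
  assumes "1 \<le> k" "k < n"
  shows "set_mset (proots (char_poly (single_card_matrix n k)) - {#1#}) =
         {x. char_eqn k (n - k) x \<and> x \<noteq> 1}"
proof -
  obtain c :: complex where c: "c \<noteq> 0"
    and ev: "\<And>x. poly (char_poly (single_card_matrix n k)) x =
           c * ((2 * x - 1) ^ k * (2 * x ^ (n - k) - 1) - 1)"
    using char_poly_single_card[OF assms] by blast
  define P where "P = char_poly (single_card_matrix n k)"
  \<comment> \<open>A closed form of the characteristic polynomial, equal to it because both agree
    pointwise; its derivative at 1 is explicit.\<close>
  define R :: "complex poly" where
    "R = [:c:] * ([:-1, 2:] ^ k * ([:2:] * [:0, 1:] ^ (n - k) - 1) - 1)"
  have lin: "poly [:-1, 2:] x = 2 * x - 1" for x :: complex by simp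
  have "poly R x = c * ((2 * x - 1) ^ k * (2 * x ^ (n - k) - 1) - 1)" for x
    unfolding R_def poly_mult poly_diff poly_power lin by simp
  then have PR: "P = R"
    unfolding P_def using ev by (intro poly_ext) simp
  have A: "single_card_matrix n k \<in> carrier_mat n n"
    by (simp add: single_card_matrix_def)
  have P0: "P \<noteq> 0"
    using degree_monic_char_poly[OF A] by (auto simp: P_def)
  have "(poly R has_field_derivative c * (2 * of_nat k + 2 * of_nat (n - k))) (at 1)"
  proof -
    have "((\<lambda>x::complex. c * ((2 * x - 1) ^ k * (2 * x ^ (n - k) - 1) - 1)) has_field_derivative
        c * (2 * of_nat k + 2 * of_nat (n - k))) (at 1)"
      by (auto intro!: derivative_eq_intros)
    moreover have "poly R = (\<lambda>x. c * ((2 * x - 1) ^ k * (2 * x ^ (n - k) - 1) - 1))"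
      using ev PR P_def by auto
    ultimately show ?thesis by simp
  qed
  moreover have "(poly R has_field_derivative poly (pderiv R) 1) (at 1)"
    by (rule poly_DERIV)
  ultimately have "poly (pderiv P) 1 = c * (2 * of_nat k + 2 * of_nat (n - k))"
    using PR DERIV_unique by blast
  also have "\<dots> = c * of_nat (2 * n)"
    using assms by (simp add: of_nat_diff)
  finally have d: "poly (pderiv P) 1 \<noteq> 0"
    using c assms by auto
  have "order 1 P = 1"
  proof -
    have "poly P 1 = 0" using ev P_def by auto
    then have "order 1 P = Suc (order 1 (pderiv P))"
      using P0 by (intro order_pderiv)
    moreover have "order 1 (pderiv P) = 0"
      using d by (rule order_0I)
    ultimately show ?thesis by simp
  qed
  then have one: "count (proots P) 1 = 1" using P0 by simp
  have "x \<in># proots P - {#1#} \<longleftrightarrow> poly P x = 0 \<and> x \<noteq> 1" for x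
  proof (cases "x = 1")
    case True
    then show ?thesis using one by (simp add: not_in_iff)
  next
    case False
    then show ?thesis using P0 order_root[of P x] by (auto simp: in_diff_count)
  qed
  then show ?thesis using ev c unfolding P_def by auto
qed

subsection \<open>Expansion of the logarithm\<close>

text \<open>On the disc \<open>norm z \<le> 1/8\<close> used throughout,
  \<open>2 * exp z - 1\<close> stays within 1/2 of 1, so the principal branch is analytic
  there.\<close>

definition clog :: "complex \<Rightarrow> complex" where
  "clog z = Ln (2 * exp z - 1)"

definition clog_err :: "complex \<Rightarrow> complex" where
  "clog_err z = clog z - 2 * z"

lemma norm_two_exp_minus_2:
  assumes "norm (z :: complex) \<le> 1/8"
  shows "norm (2 * exp z - 2) \<le> 1/2"
proof -
  have B: "norm (exp x) \<le> 2" if "x \<in> cball 0 (1/8)" for x :: complex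
    using that by (intro exp_bound_half) auto
  \<comment> \<open>Taylor expansion of order zero: the bound 2 on the derivative gives
    \<open>norm (exp z - 1) \<le> 2 * norm z\<close>, which is at most 1/4.\<close>
  have "norm ((\<lambda>_. exp) (0::nat) z - (\<Sum>i\<le>0. (\<lambda>_. exp) i 0 * (z - 0) ^ i / fact i))
      \<le> 2 * norm (z - 0) ^ Suc 0 / fact 0"
    by (rule complex_Taylor[of "cball 0 (1/8)"])
      (use assms in \<open>auto intro!: derivative_eq_intros B simp del: norm_exp_eq_Re\<close>)
  then have "norm (exp z - 1) \<le> 2 * norm z" by simp
  moreover have "norm (2 * exp z - 2) = 2 * norm (exp z - 1)"
  proof -
    have "2 * exp z - 2 = 2 * (exp z - 1)" by simp
    then show ?thesis by (simp only: norm_mult norm_numeral)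
  qed
  ultimately show ?thesis using assms by linarith
qed

lemma two_exp_minus_1_bounds:
  assumes "norm (z :: complex) \<le> 1/8"
  shows "Re (2 * exp z - 1) > 0" "norm (2 * exp z - 1) \<ge> 1/2"
proof -
  have "\<bar>Re (2 * exp z - 2)\<bar> \<le> 1/2"
    using norm_two_exp_minus_2[OF assms] abs_Re_le_cmod order_trans by blast
  moreover have "Re (2 * exp z - 2) = Re (2 * exp z - 1) - 1" by simp
  ultimately show "Re (2 * exp z - 1) > 0" by linarith
  have "norm (1::complex) \<le> norm (2 * exp z - 1) + norm (2 * exp z - 2)"
    using norm_triangle_ineq4[of "2 * exp z - 1" "2 * exp z - 2"] by simp
  then show "norm (2 * exp z - 1) \<ge> 1/2"
    using norm_two_exp_minus_2[OF assms] by simp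
qed

lemma exp_clog:
  assumes "norm z \<le> 1/8"
  shows "exp (clog z) = 2 * exp z - 1"
  unfolding clog_def using two_exp_minus_1_bounds[OF assms] by (intro exp_Ln) auto

lemma clog_deriv:
  assumes "norm z \<le> 1/8"
  shows "(clog has_field_derivative 1 + inverse (2 * exp z - 1)) (at z within S)"
proof -
  have "2 * exp z - 1 \<noteq> 0" using two_exp_minus_1_bounds[OF assms] by auto
  moreover have "2 * exp z - 1 \<notin> \<real>\<^sub>\<le>\<^sub>0"
    using two_exp_minus_1_bounds[OF assms] by (auto simp: complex_nonpos_Reals_iff)
  ultimately show ?thesis
    unfolding clog_def[abs_def]
    by (auto intro!: derivative_eq_intros simp: field_simps)
qed

text \<open>With \<open>v = 1 / (2 * exp z - 1)\<close> one has \<open>clog' = 1 + v\<close> and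
  \<open>v' = - (v + v^2)\<close>, so all higher derivatives are polynomials in \<open>v\<close>,
  and \<open>norm v \<le> 2\<close> on the disc.\<close>

lemma clog_taylor:
  assumes "norm z \<le> 1/8"
  shows "norm (clog z - 2 * z + z\<^sup>2) \<le> 15 * norm z ^ 3"
proof -
  define v :: "complex \<Rightarrow> complex" where "v z = inverse (2 * exp z - 1)" for z
  define f :: "nat \<Rightarrow> complex \<Rightarrow> complex" where
    "f i = (if i = 0 then clog else if i = 1 then (\<lambda>z. 1 + v z)
      else if i = 2 then (\<lambda>z. - (v z + v z ^ 2)) else (\<lambda>z. (1 + 2 * v z) * (v z + v z ^ 2)))" for i
  have v: "(v has_field_derivative - (v x + v x ^ 2)) (at x within S)" if "norm x \<le> 1/8" for x S
  proof -
    define D where "D = 2 * exp x - 1"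
    have D: "D \<noteq> 0" using two_exp_minus_1_bounds[OF that] by (auto simp: D_def)
    have "(v has_field_derivative - (inverse D * (2 * exp x) * inverse D)) (at x within S)"
      using D unfolding v_def[abs_def] D_def by (auto intro!: derivative_eq_intros)
    also have "2 * exp x = D + 1" by (simp add: D_def)
    also have "inverse D * (D + 1) * inverse D = v x + v x ^ 2"
    proof -
      have v: "v x = inverse D" by (simp add: v_def D_def)
      show ?thesis unfolding v using D by (simp add: field_simps power2_eq_square)
    qed
    finally show ?thesis .
  qed
  \<comment> \<open>The third derivative \<open>(1 + 2 * v) * (v + v^2)\<close> is bounded by 5 * 6
    = 30; dividing by \<open>fact 2\<close> gives the constant 15.\<close>
  have "norm (f 0 z - (\<Sum>i\<le>2. f i 0 * (z - 0) ^ i / fact i)) \<le> 30 * norm (z - 0) ^ Suc 2 / fact 2"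
  proof (rule complex_Taylor[of "cball 0 (1/8)"])
    fix i :: nat and x :: complex
    assume "x \<in> cball 0 (1/8)" "i \<le> 2"
    then have x: "norm x \<le> 1/8" and i: "i = 0 \<or> i = 1 \<or> i = 2" by auto
    have v1: "((\<lambda>z. 1 + v z) has_field_derivative 0 + - (v x + v x ^ 2)) (at x within cball 0 (1/8))"
      by (intro DERIV_add DERIV_const v[OF x])
    have "((\<lambda>z. - (v z + v z ^ 2)) has_field_derivative
        - (- (v x + v x ^ 2) + of_nat 2 * (- (v x + v x ^ 2) * v x ^ (2 - Suc 0)))) (at x within cball 0 (1/8))"
      by (intro DERIV_minus DERIV_add DERIV_power v[OF x])
    also have "- (- (v x + v x ^ 2) + of_nat 2 * (- (v x + v x ^ 2) * v x ^ (2 - Suc 0))) =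
        (1 + 2 * v x) * (v x + v x ^ 2)"
      by (simp add: algebra_simps power2_eq_square)
    finally have v2: "((\<lambda>z. - (v z + v z ^ 2)) has_field_derivative
        (1 + 2 * v x) * (v x + v x ^ 2)) (at x within cball 0 (1/8))" .
    have v0: "(clog has_field_derivative 1 + v x) (at x within cball 0 (1/8))"
      using clog_deriv[OF x] by (simp add: v_def)
    show "(f i has_field_derivative f (Suc i) x) (at x within cball 0 (1/8))"
      using i v0 v1 v2 by (elim disjE) (simp_all add: f_def)
  next
    fix x :: complex assume "x \<in> cball 0 (1/8)"
    then have x: "norm x \<le> 1/8" by simp
    have b: "norm (v x) \<le> 2"
      using le_imp_inverse_le[OF two_exp_minus_1_bounds(2)[OF x]] by (simp add: v_def norm_inverse)
    have "norm (1 + 2 * v x) \<le> 1 + 2 * 2"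
      using norm_triangle_ineq[of 1 "2 * v x"] b by (simp add: norm_mult)
    moreover have "norm (v x + v x ^ 2) \<le> 2 + 2 ^ 2"
      using norm_triangle_ineq[of "v x" "v x ^ 2"] b power_mono[OF b, of 2] by (simp add: norm_power)
    ultimately have "norm ((1 + 2 * v x) * (v x + v x ^ 2)) \<le> (1 + 2 * 2) * (2 + 2 ^ 2)"
      unfolding norm_mult by (intro mult_mono) auto
    then show "norm (f (Suc 2) x) \<le> 30" by (simp add: f_def)
  qed (use assms in auto)
  moreover have "(\<Sum>i\<le>2. f i 0 * (z - 0) ^ i / fact i) = 2 * z - z\<^sup>2"
    by (simp add: f_def v_def clog_def numeral_2_eq_2)
  moreover have "f 0 z = clog z" by (simp add: f_def)
  ultimately have "norm (clog z - (2 * z - z\<^sup>2)) \<le> 30 * norm z ^ 3 / 2"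
    by (simp add: eval_nat_numeral)
  then show ?thesis by (simp add: algebra_simps)
qed

lemma clog_err_bound:
  assumes "norm z \<le> 1/8"
  shows "norm (clog_err z) \<le> 3 * norm z ^ 2"
proof -
  have "norm (clog_err z) \<le> norm (clog z - 2 * z + z\<^sup>2) + norm (z\<^sup>2)"
    using norm_triangle_ineq4[of "clog z - 2 * z + z\<^sup>2" "z\<^sup>2"] by (simp add: clog_err_def)
  also have "\<dots> \<le> 15 * norm z ^ 3 + norm z ^ 2"
    using clog_taylor[OF assms] by (simp add: norm_power)
  also have "15 * norm z ^ 3 = (15 * norm z) * norm z ^ 2"
    by (simp add: power3_eq_cube power2_eq_square)
  also have "\<dots> \<le> 2 * norm z ^ 2"
    using assms by (intro mult_right_mono) auto
  finally show ?thesis by simp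
qed

lemma continuous_on_clog_err: "continuous_on (cball 0 (1/8)) clog_err"
proof -
  have "continuous_on (cball 0 (1/8)) clog"
    using clog_deriv by (intro DERIV_continuous_on) auto
  then show ?thesis unfolding clog_err_def[abs_def] by (intro continuous_intros)
qed

subsection \<open>The rescaled eigenvalue equation\<close>

text \<open>Only the ratio is known to be positive: \<open>p\<close> and \<open>q\<close> may both
  be negative. Later arguments therefore rely on \<open>slope * q = p\<close> and
  \<open>q \<noteq> 0\<close>.\<close>

locale rational_slope =
  fixes p q :: int
  assumes slope_pos: "0 < real_of_int p / real_of_int q"
    and slope_less_1: "real_of_int p / real_of_int q < 1"
    and coprime_pq: "gcd p q = 1"
begin

definition slope :: real where
  "slope = real_of_int p / real_of_int q"

definition k :: "nat \<Rightarrow> nat" where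
  "k n = nat \<lfloor>slope * real n\<rfloor>"

definition m :: "nat \<Rightarrow> nat" where
  "m n = n - k n"

section \<open>Rounding estimates for \<open>k\<close>\<close>

lemma slope: "0 < slope" "slope < 1" "q \<noteq> 0" "slope * q = p"
  using slope_pos slope_less_1 by (auto simp: slope_def)

lemma k_bounds: "real (k n) \<le> slope * n" "slope * n - 1 \<le> real (k n)"
proof -
  have "\<lfloor>slope * real n\<rfloor> \<ge> 0" using slope by simp
  then have "real (k n) = of_int \<lfloor>slope * real n\<rfloor>"
    unfolding k_def by simp
  then show "real (k n) \<le> slope * n" "slope * n - 1 \<le> real (k n)" by linarith+
qed

lemma k_le: "k n \<le> n"
proof -
  have "slope * n \<le> 1 * real n" using slope by (intro mult_right_mono) auto
  then show ?thesis using k_bounds(1)[of n] by linarith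
qed

lemma real_m: "real (m n) = real n - real (k n)"
  using k_le by (simp add: m_def of_nat_diff)

lemma ratio_k: "n > 0 \<Longrightarrow> \<bar>real (k n) / n - slope\<bar> \<le> 1 / n"
proof -
  assume "n > 0"
  then have "real (k n) / n - slope = (k n - slope * n) / n" by (simp add: field_simps)
  also have "\<bar>\<dots>\<bar> \<le> 1 / n"
    using k_bounds[of n] \<open>n > 0\<close> by (auto simp: abs_divide intro!: divide_right_mono)
  finally show ?thesis .
qed

lemma eventually_k: "eventually (\<lambda>n. slope / 2 * n \<le> k n \<and> 1 \<le> k n \<and> k n < n) sequentially"
proof -
  \<comment> \<open>Beyond \<open>2 / slope\<close> one has \<open>slope * n > 2\<close>, so the 1
    lost to the floor is at most half of \<open>slope * n\<close>.\<close>
  obtain N :: nat where N: "2 / slope < real N" using reals_Archimedean2 by blast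
  have "slope / 2 * n \<le> k n \<and> 1 \<le> k n \<and> k n < n" if "n \<ge> max N 1" for n
  proof -
    have "2 / slope < real n" using that N by linarith
    then have "slope * n > 2" using slope by (simp add: field_simps)
    then have "slope / 2 * n \<le> k n" "1 \<le> k n" using k_bounds(2)[of n] by auto
    moreover have "slope * n < 1 * real n"
      using that slope by (intro mult_strict_right_mono) auto
    then have "k n < n" using k_bounds(1)[of n] by linarith
    ultimately show ?thesis by simp
  qed
  then show ?thesis unfolding eventually_sequentially by blast
qed

lemma ratio_k_tendsto: "(\<lambda>n. real (k n) / n) \<longlonglongrightarrow> slope"
proof (rule Lim_transform_eventually)
  have "(\<lambda>n. real (k n) / n - slope) \<longlonglongrightarrow> 0"
    by (rule Lim_null_comparison[OF _ lim_1_over_n])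
      (use ratio_k in \<open>auto intro!: eventually_sequentiallyI[of 1]\<close>)
  from tendsto_add[OF this tendsto_const[of slope]]
  show "(\<lambda>n. real (k n) / n - slope + slope) \<longlonglongrightarrow> slope" by simp
qed simp

section \<open>Limit frequencies and the logarithmic form of the equation\<close>

definition freq :: "int \<Rightarrow> complex" where
  "freq t = \<i> * of_real (pi * q * t)"

text \<open>For even \<open>(q - p) * t\<close>, the points \<open>freq t\<close> are the imaginary solutions of the limit equation
  \<open>exp (2 * slope * w) * (2 * exp ((1 - slope) * w) - 1) = 1\<close>, where \<open>w = n * Ln x\<close>.\<close>

definition defect :: "int \<Rightarrow> nat \<Rightarrow> complex \<Rightarrow> complex" where
  "defect t n w = of_nat (k n) * clog (w / of_nat n) +
     clog (of_nat (m n) / of_nat n * w - of_real (1 - slope) * freq t) - 2 * of_real slope * freq t"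

text \<open>By \<open>slope * q = p\<close> the two exponents are
  \<open>\<i> * pi * (q - p) * t\<close> and \<open>2 * pi * \<i> * p * t\<close>, both integer
  multiples of \<open>2 * pi * \<i>\<close>.\<close>

lemma exp_freq:
  assumes "even ((q - p) * t)"
  shows "exp (of_real (1 - slope) * freq t) = 1" "exp (2 * of_real slope * freq t) = 1"
proof -
  from assms obtain s where s: "(q - p) * t = 2 * s" unfolding dvd_def by blast
  have fr: "of_real x * freq t = \<i> * of_real (x * (pi * q * t))" for x
    by (simp add: freq_def)
  have "(1 - slope) * (pi * q * t) = pi * ((q - slope * q) * t)" by (simp add: algebra_simps)
  also have "\<dots> = pi * real_of_int ((q - p) * t)" by (simp add: slope)
  also have "\<dots> = 2 * pi * s" unfolding s by simp
  finally have e: "(1 - slope) * (pi * q * t) = 2 * pi * s" .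
  have "of_real (1 - slope) * freq t = 2 * of_int s * of_real pi * \<i>"
    unfolding fr e by simp
  then show "exp (of_real (1 - slope) * freq t) = 1"
    using exp_integer_2pi[of "of_int s"] by simp
  have "(2 * slope) * (pi * q * t) = 2 * pi * ((slope * q) * t)" by (simp add: algebra_simps)
  also have "\<dots> = 2 * pi * real_of_int (p * t)" by (simp add: slope)
  finally have e: "(2 * slope) * (pi * q * t) = 2 * pi * real_of_int (p * t)" .
  have e': "2 * of_real slope * freq t = 2 * of_int (p * t) * of_real pi * \<i>"
    using fr[of "2 * slope"] unfolding e by simp
  show "exp (2 * of_real slope * freq t) = 1"
    unfolding e' using exp_integer_2pi[of "of_int (p * t)"] by simp
qed

text \<open>\<open>defect\<close> is a logarithm of the left side of the characteristic equation at
  \<open>exp (w / n)\<close>. The shifts by multiples of \<open>2 * pi * \<i>\<close> keep both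
  arguments of \<open>clog\<close>, and \<open>defect\<close> itself, close to 0 when
  \<open>w\<close> is near \<open>freq t\<close>.\<close>

lemma exp_defect:
  assumes "even ((q - p) * t)" "n > 0" "norm (w / of_nat n) \<le> 1/8"
    and "norm (of_nat (m n) / of_nat n * w - of_real (1 - slope) * freq t) \<le> 1/8"
  shows "exp (defect t n w) = (2 * exp (w / n) - 1) ^ k n * (2 * exp (w / n) ^ m n - 1)"
proof -
  have "exp (of_nat (m n) / of_nat n * w - of_real (1 - slope) * freq t) = exp (of_nat (m n) * (w / of_nat n))"
    unfolding exp_diff exp_freq(1)[OF assms(1)] by simp
  also have "\<dots> = exp (w / n) ^ m n" by (rule exp_of_nat_mult)
  finally have y: "exp (of_nat (m n) / of_nat n * w - of_real (1 - slope) * freq t) = exp (w / n) ^ m n" .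
  have "exp (defect t n w) = exp (clog (w / of_nat n)) ^ k n *
      exp (clog (of_nat (m n) / of_nat n * w - of_real (1 - slope) * freq t)) / exp (2 * of_real slope * freq t)"
    by (simp only: defect_def exp_diff exp_add exp_of_nat_mult)
  then show ?thesis
    unfolding exp_clog[OF assms(3)] exp_clog[OF assms(4)] exp_freq(2)[OF assms(1)] y by simp
qed

lemma phase_bound:
  assumes "n > 0"
  shows "norm (of_nat (m n) / of_nat n * w - of_real (1 - slope) * freq t)
           \<le> norm (w - freq t) + norm (freq t) / n"
proof -
  have expand: "of_real a * w - of_real b * z = of_real a * (w - z) + of_real (a - b) * z"
    for a b :: real and z :: complex by (simp add: algebra_simps)
  have m: "of_nat (m n) / of_nat n = complex_of_real (m n / n)" by simp
  \<comment> \<open>The two terms separate the distance from \<open>w\<close> to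
    \<open>freq t\<close> from the rounding error of \<open>m n / n\<close>, which is at most
    \<open>1 / n\<close>.\<close>
  have "of_nat (m n) / of_nat n * w - of_real (1 - slope) * freq t =
      of_real (m n / n) * (w - freq t) + of_real (m n / n - (1 - slope)) * freq t"
    unfolding m by (rule expand)
  also have "norm \<dots> \<le> (m n / n) * norm (w - freq t) + \<bar>m n / n - (1 - slope)\<bar> * norm (freq t)"
    by (rule norm_triangle_le) (simp add: norm_mult del: of_real_diff of_real_divide)
  also have "\<dots> \<le> 1 * norm (w - freq t) + (1 / n) * norm (freq t)"
  proof (intro add_mono mult_right_mono)
    show "real (m n) / n \<le> 1" using assms by (simp add: m_def)
    have "real (m n) / n - (1 - slope) = - (k n / n - slope)"
      using assms by (simp add: real_m field_simps)
    then show "\<bar>m n / n - (1 - slope)\<bar> \<le> 1 / n" using ratio_k[OF assms] by simp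
  qed auto
  finally show ?thesis by simp
qed


text \<open>The linear parts of the logarithms add up to \<open>2 * w\<close> since
  \<open>k n + m n = n\<close>, and the shifts add up to \<open>2 * freq t\<close>.\<close>

lemma defect_expand:
  assumes "n > 0"
  shows "defect t n w = 2 * (w - freq t) + of_nat (k n) * clog_err (w / of_nat n) +
     clog_err (of_nat (m n) / of_nat n * w - of_real (1 - slope) * freq t)"
proof -
  define z where "z = w / of_nat n"
  define y where "y = of_nat (m n) / of_nat n * w - of_real (1 - slope) * freq t"
  have km0: "k n + m n = n" using k_le[of n] by (simp add: m_def)
  have km: "of_nat (k n) + of_nat (m n) = (of_nat n :: complex)"
    unfolding of_nat_add[symmetric] km0 ..
  have "of_nat (k n) * z + of_nat (m n) / of_nat n * w
      = (of_nat (k n) + of_nat (m n)) / of_nat n * w"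
    unfolding z_def by (simp only: add_divide_distrib ring_distribs times_divide_eq_left times_divide_eq_right)
  then have w: "of_nat (k n) * z + of_nat (m n) / of_nat n * w = w"
    using assms unfolding km by simp
  have gen: "2 * (w - f) + a * (c - 2 * z) + (d - 2 * (M * w - b * f)) =
      a * c + d - 2 * s * f + 2 * (w - (a * z + M * w))"
    if "b = 1 - s" for a b c d f s M :: complex
    unfolding that by (simp add: algebra_simps)
  have "2 * (w - freq t) + of_nat (k n) * (clog z - 2 * z) + (clog y - 2 * y) =
      of_nat (k n) * clog z + clog y - 2 * of_real slope * freq t
        + 2 * (w - (of_nat (k n) * z + of_nat (m n) / of_nat n * w))"
    unfolding y_def by (rule gen) simp
  then show ?thesis
    unfolding defect_def clog_err_def z_def[symmetric] y_def[symmetric] w by simp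
qed

text \<open>The error is quadratic, so \<open>k n \<le> n\<close> copies of it at scale
  \<open>1 / n\<close> still leave a factor \<open>1 / n\<close>.\<close>

lemma scaled_clog_err_bound:
  assumes "n > 0" "norm (w / of_nat n) \<le> 1/8"
  shows "norm (of_nat (k n) * clog_err (w / of_nat n)) \<le> 3 * norm w ^ 2 / n"
proof -
  have "norm (of_nat (k n) * clog_err (w / of_nat n)) \<le> real n * (3 * norm (w / of_nat n) ^ 2)"
    unfolding norm_mult using clog_err_bound[OF assms(2)] k_le[of n]
    by (intro mult_mono) auto
  also have "\<dots> = 3 * norm w ^ 2 / n"
    using assms(1) by (simp add: norm_divide power_divide power2_eq_square)
  finally show ?thesis .
qed

section \<open>Existence of roots near the limit frequencies\<close>

text \<open>A zero of \<open>defect\<close> at \<open>freq t + u\<close> is a fixed point of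
  \<open>T\<close>, and Brouwer's theorem applies on the ball of radius \<open>D / n\<close>.
  \<open>W\<close> bounds \<open>w\<close> on that ball and \<open>D = 3 * W^2\<close> bounds the
  first error after scaling. The lower bound on \<open>n\<close> makes the second error at most
  \<open>D / n\<close> too.\<close>

lemma root_near_freq:
  assumes t: "even ((q - p) * t)"
    and W: "W = norm (freq t) + 1" and D: "D = 3 * W ^ 2"
    and n: "8 * (D + W) ^ 2 \<le> real n"
  shows "\<exists>w. norm (w - freq t) \<le> D / n \<and> char_eqn (k n) (m n) (exp (w / of_nat n))"
proof -
  have W1: "W \<ge> 1" using W by simp
  then have D3: "D \<ge> 3" using D by (simp add: one_le_power)
  \<comment> \<open>Since \<open>D + W \<ge> 1\<close>, the quadratic lower bound on
    \<open>n\<close> implies a linear one, which puts \<open>z u\<close> and \<open>y u\<close> into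
    the disc of radius 1/8.\<close>
  have "1 * (D + W) \<le> (D + W) * (D + W)"
    using W1 D3 by (intro mult_right_mono) auto
  then have n': "8 * (D + W) \<le> real n" using n by (simp add: power2_eq_square)
  then have n0: "n > 0" using W1 D3 by (cases n) auto
  define z y T where "z u = (freq t + u) / of_nat n"
    and "y u = of_nat (m n) / of_nat n * (freq t + u) - of_real (1 - slope) * freq t"
    and "T u = - (of_nat (k n) * clog_err (z u) + clog_err (y u)) / 2" for u
  have zy: "norm (z u) \<le> 1/8" "norm (y u) \<le> (D + W) / n" "norm (y u) \<le> 1/8" "norm (freq t + u) \<le> W"
    if "u \<in> cball 0 (D / n)" for u
  proof -
    have u: "norm u \<le> D / n" using that by simp
    also have "\<dots> \<le> 1" using n' n0 W1 D3 by (simp add: field_simps)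
    finally show fu: "norm (freq t + u) \<le> W"
      using norm_triangle_ineq[of "freq t" u] by (simp add: W)
    then show "norm (z u) \<le> 1/8"
      using n' n0 W1 D3 by (simp add: z_def norm_divide field_simps)
    have "norm (y u) \<le> norm u + norm (freq t) / n"
      using phase_bound[OF n0, of "freq t + u" t] by (simp add: y_def)
    also have "\<dots> \<le> D / n + W / n"
      using u by (intro add_mono divide_right_mono) (auto simp: W)
    finally show y: "norm (y u) \<le> (D + W) / n" by (simp add: add_divide_distrib)
    also have "\<dots> \<le> 1/8" using n' n0 by (simp add: field_simps)
    finally show "norm (y u) \<le> 1/8" .
  qed
  have cont: "continuous_on (cball 0 (D / n)) T"
    unfolding T_def[abs_def] using zy n0
    by (auto intro!: continuous_intros continuous_on_compose2[OF continuous_on_clog_err] simp: z_def y_def)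
  have "norm (T u) \<le> D / n" if u: "u \<in> cball 0 (D / n)" for u
  proof -
    have "norm (of_nat (k n) * clog_err (z u)) \<le> 3 * norm (freq t + u) ^ 2 / n"
      using scaled_clog_err_bound[OF n0] zy(1)[OF u] by (simp add: z_def)
    also have "\<dots> \<le> 3 * W ^ 2 / n"
      using zy(4)[OF u] by (intro divide_right_mono mult_left_mono power_mono) auto
    finally have 1: "norm (of_nat (k n) * clog_err (z u)) \<le> D / n" by (simp add: D)
    have "norm (clog_err (y u)) \<le> 3 * norm (y u) ^ 2"
      by (rule clog_err_bound[OF zy(3)[OF u]])
    also have "\<dots> \<le> 3 * ((D + W) / n) ^ 2"
      using zy(2)[OF u] by (intro mult_left_mono power_mono) auto
    also have "\<dots> = (3 * (D + W) ^ 2 / n) / n"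
      by (simp add: power_divide power2_eq_square)
    also have "\<dots> \<le> D / n"
    proof (intro divide_right_mono)
      have "3 * (D + W) ^ 2 \<le> 1 * real n" using n zero_le_power2[of "D + W"] by linarith
      also have "\<dots> \<le> D * real n" using D3 by (intro mult_right_mono) auto
      finally show "3 * (D + W) ^ 2 / n \<le> D" using n0 by (simp add: pos_divide_le_eq)
    qed simp
    finally have 2: "norm (clog_err (y u)) \<le> D / n" .
    have "norm (of_nat (k n) * clog_err (z u) + clog_err (y u)) \<le> D / n + D / n"
      using 1 2 by (rule norm_triangle_mono)
    then show ?thesis unfolding T_def norm_divide norm_minus_cancel by (simp add: mult.commute)
  qed
  then have "T \<in> cball 0 (D / n) \<rightarrow> cball 0 (D / n)" by auto
  moreover have "D / n > 0" using D3 n0 by simp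
  ultimately obtain u where u: "u \<in> cball 0 (D / n)" "T u = u"
    using brouwer_ball[OF _ cont] by blast
  have half: "a = 2 * - (- a / 2)" for a :: complex by simp
  have "defect t n (freq t + u) = 2 * u + (of_nat (k n) * clog_err (z u) + clog_err (y u))"
    unfolding defect_expand[OF n0] y_def z_def by (simp only: add_diff_cancel_left' add.assoc)
  also have "\<dots> = 2 * u + 2 * - T u"
    unfolding T_def by (rule arg_cong[OF half])
  also have "\<dots> = 0" using u by simp
  finally have "defect t n (freq t + u) = 0" .
  then have "char_eqn (k n) (m n) (exp ((freq t + u) / of_nat n))"
    using exp_defect[OF t n0, of "freq t + u"] zy[OF u(1)] by (simp add: z_def y_def)
  then show ?thesis using u(1) by (intro exI[of _ "freq t + u"]) simp
qed

lemma roots_tendsto_freq: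
  assumes t: "even ((q - p) * t)"
  obtains w where "w \<longlonglongrightarrow> freq t"
    and "eventually (\<lambda>n. char_eqn (k n) (m n) (exp (w n / of_nat n))) sequentially"
proof -
  define W where "W = norm (freq t) + 1"
  define D where "D = 3 * W ^ 2"
  have "\<exists>w. 8 * (D + W) ^ 2 \<le> real n \<longrightarrow>
      norm (w - freq t) \<le> D / n \<and> char_eqn (k n) (m n) (exp (w / of_nat n))" for n
    using root_near_freq[OF t W_def D_def] by blast
  then obtain w where w: "8 * (D + W) ^ 2 \<le> real n \<Longrightarrow>
      norm (w n - freq t) \<le> D / n \<and> char_eqn (k n) (m n) (exp (w n / of_nat n))" for n
    by metis
  have ev: "eventually (\<lambda>n. 8 * (D + W) ^ 2 \<le> real n) sequentially"
    using filterlim_real_sequentially by (simp add: filterlim_at_top)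
  have "(\<lambda>n. w n - freq t) \<longlonglongrightarrow> 0"
  proof (rule Lim_null_comparison)
    show "eventually (\<lambda>n. norm (w n - freq t) \<le> D / n) sequentially"
      using ev by eventually_elim (use w in auto)
    show "(\<lambda>n. D / real n) \<longlonglongrightarrow> 0" by (rule lim_const_over_n)
  qed
  then have "w \<longlonglongrightarrow> freq t" by (simp add: LIM_zero_iff)
  moreover have "eventually (\<lambda>n. char_eqn (k n) (m n) (exp (w n / of_nat n))) sequentially"
    using ev by eventually_elim (use w in auto)
  ultimately show thesis by (rule that)
qed

end

subsection \<open>Convergent sequences of roots\<close>

text \<open>The parallelogram law for \<open>x\<close> and \<open>x - 1\<close>, whose difference is
  1.\<close>

lemma norm_two_times_minus_1:
  "norm (2 * x - 1 :: complex) ^ 2 = 2 * norm (x - 1) ^ 2 + 2 * norm x ^ 2 - 1"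
  by (simp add: cmod_power2) (simp add: power2_eq_square algebra_simps)

text \<open>The indices \<open>N\<close> are left general because this is used both for constructed
  roots at every \<open>n\<close> and for subsequences extracted by compactness.\<close>

locale root_sequence = rational_slope +
  fixes N :: "nat \<Rightarrow> nat" and w :: "nat \<Rightarrow> complex" and w0 :: complex
  assumes N: "filterlim N at_top sequentially"
    and w_lim: "w \<longlonglongrightarrow> w0"
    and root: "eventually (\<lambda>j. char_eqn (k (N j)) (m (N j)) (exp (w j / of_nat (N j)))) sequentially"
begin

lemma N_pos: "eventually (\<lambda>j. N j > 0) sequentially"
  using N[unfolded filterlim_at_top, rule_format, of 1] by (auto elim: eventually_mono)

lemma inverse_N: "(\<lambda>j. 1 / real (N j)) \<longlonglongrightarrow> 0"
  using filterlim_compose[OF lim_1_over_n N] by simp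

lemma norm_w_over_N: "(\<lambda>j. norm (w j / of_nat (N j))) \<longlonglongrightarrow> 0"
proof -
  have "(\<lambda>j. norm (w j) * (1 / real (N j))) \<longlonglongrightarrow> norm w0 * 0"
    by (intro tendsto_intros w_lim inverse_N)
  then show ?thesis by (simp add: norm_divide)
qed

lemma w_over_N_small: "eventually (\<lambda>j. norm (w j / of_nat (N j)) \<le> 1/8) sequentially"
  using order_tendstoD(2)[OF norm_w_over_N, of "1/8"] by (auto elim: eventually_mono)

lemma scaled_clog_err_null: "(\<lambda>j. of_nat (k (N j)) * clog_err (w j / of_nat (N j))) \<longlonglongrightarrow> 0"
proof (rule Lim_null_comparison)
  show "eventually (\<lambda>j. norm (of_nat (k (N j)) * clog_err (w j / of_nat (N j)))
      \<le> 3 * norm (w j) ^ 2 * (1 / real (N j))) sequentially"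
    using N_pos w_over_N_small by eventually_elim (use scaled_clog_err_bound in auto)
  have "(\<lambda>j. 3 * norm (w j) ^ 2 * (1 / real (N j))) \<longlonglongrightarrow> 3 * norm w0 ^ 2 * 0"
    by (intro tendsto_intros w_lim inverse_N)
  then show "(\<lambda>j. 3 * norm (w j) ^ 2 * (1 / real (N j))) \<longlonglongrightarrow> 0" by simp
qed

lemma ratio_kN: "(\<lambda>j. complex_of_real (real (k (N j)) / real (N j))) \<longlonglongrightarrow> of_real slope"
  using filterlim_compose[OF ratio_k_tendsto N] by (intro tendsto_of_real) simp

section \<open>Identification of the limit points\<close>

lemma limit_equation: "exp (2 * of_real slope * w0) * (2 * exp (of_real (1 - slope) * w0) - 1) = 1"
proof -
  let ?r = "\<lambda>j. complex_of_real (real (k (N j)) / real (N j))"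
  have lim: "(\<lambda>j. exp (2 * ?r j * w j + of_nat (k (N j)) * clog_err (w j / of_nat (N j)))
      * (2 * exp ((1 - ?r j) * w j) - 1)) \<longlonglongrightarrow>
      exp (2 * of_real slope * w0 + 0) * (2 * exp ((1 - of_real slope) * w0) - 1)"
    by (intro tendsto_intros ratio_kN w_lim scaled_clog_err_null)
  have "eventually (\<lambda>j. exp (2 * ?r j * w j + of_nat (k (N j)) * clog_err (w j / of_nat (N j)))
      * (2 * exp ((1 - ?r j) * w j) - 1) = 1) sequentially"
    using N_pos w_over_N_small root
  proof eventually_elim
    case (elim j)
    have "2 * ?r j * w j + of_nat (k (N j)) * clog_err (w j / of_nat (N j)) =
        of_nat (k (N j)) * clog (w j / of_nat (N j))"
      by (simp add: clog_err_def algebra_simps)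
    then have 1: "exp (2 * ?r j * w j + of_nat (k (N j)) * clog_err (w j / of_nat (N j))) =
        (2 * exp (w j / of_nat (N j)) - 1) ^ k (N j)"
      by (simp only: exp_of_nat_mult exp_clog[OF elim(2)])
    have "real (m (N j)) / real (N j) = 1 - real (k (N j)) / real (N j)"
      using elim(1) by (simp add: real_m diff_divide_distrib)
    then have "1 - ?r j = of_real (real (m (N j)) / real (N j))" by simp
    then have "(1 - ?r j) * w j = of_nat (m (N j)) * (w j / of_nat (N j))" by simp
    then have 2: "exp ((1 - ?r j) * w j) = exp (w j / of_nat (N j)) ^ m (N j)"
      by (simp only: exp_of_nat_mult)
    show ?case unfolding 1 2 by (rule elim(3))
  qed
  from tendsto_unique[OF sequentially_bot lim tendsto_eventually[OF this]]
  show ?thesis by simp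
qed

text \<open>For imaginary \<open>w0\<close> both exponentials in the limit equation have modulus 1,
  so \<open>norm x = norm (2 * x - 1) = 1\<close>. The parallelogram identity then forces
  \<open>x = 1\<close>, and what remains is arithmetic of periods.\<close>

lemma limit_is_freq:
  assumes "Re w0 = 0"
  obtains t where "even ((q - p) * t)" "w0 = freq t"
proof -
  define x where "x = exp (of_real (1 - slope) * w0)"
  have "norm x = 1" "norm (exp (2 * of_real slope * w0)) = 1"
    using assms by (simp_all add: x_def)
  moreover have "norm (exp (2 * of_real slope * w0)) * norm (2 * x - 1) = 1"
    using limit_equation by (metis norm_mult norm_one x_def)
  ultimately have "norm x = 1" "norm (2 * x - 1) = 1" by (simp_all only: mult_1)
  then have "norm (x - 1) ^ 2 = 0"
    using norm_two_times_minus_1[of x] by (simp only:) simp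
  then have x: "x = 1" by simp
  then have "exp (2 * of_real slope * w0) = 1"
    using limit_equation unfolding x_def[symmetric] by simp
  then obtain l :: int where l: "2 * slope * Im w0 = of_int (2 * l) * pi"
    by (auto simp: exp_eq_1)
  from x obtain j :: int where j: "(1 - slope) * Im w0 = of_int (2 * j) * pi"
    by (auto simp: exp_eq_1 x_def)
  \<comment> \<open>Adding the two period conditions gives \<open>Im w0\<close>. Multiplying
    \<open>slope * Im w0 = l * pi\<close> by \<open>q\<close> yields
    \<open>p * (2 * j + l) = l * q\<close>, and coprimality makes \<open>t\<close> the quotient of
    \<open>2 * j + l\<close> by \<open>q\<close>.\<close>
  have im: "Im w0 = of_int (2 * j + l) * pi" using l j by (simp add: algebra_simps)
  have "slope * Im w0 = l * pi" using l by simp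
  then have "q * (slope * Im w0) = q * (l * pi)" by simp
  then have "(slope * q) * (of_int (2 * j + l) * pi) = of_int (l * q) * pi"
    unfolding im by (simp only: mult_ac of_int_mult)
  then have "real_of_int (p * (2 * j + l)) = of_int (l * q)"
    unfolding slope by simp
  then have pl: "p * (2 * j + l) = l * q" by (simp only: of_int_eq_iff)
  then have "q dvd p * (2 * j + l)" by simp
  moreover have "coprime q p" using coprime_pq by (simp add: coprime_iff_gcd_eq_1 gcd.commute)
  ultimately have "q dvd 2 * j + l" by (simp add: coprime_dvd_mult_right_iff)
  then obtain t where t: "2 * j + l = q * t" by (auto elim: dvdE)
  have "q * l = q * (p * t)" using pl[symmetric] unfolding t by (simp only: mult_ac)
  then have "l = p * t" using slope(3) mult_left_cancel by blast
  then have "(q - p) * t = 2 * j" using t by (simp add: algebra_simps)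
  moreover have "w0 = freq t"
    using assms im unfolding t by (simp add: freq_def complex_eq_iff mult_ac)
  ultimately show thesis by (intro that) auto
qed

lemma phase_null:
  assumes "w0 = freq t"
  shows "(\<lambda>j. of_nat (m (N j)) / of_nat (N j) * w j - of_real (1 - slope) * freq t) \<longlonglongrightarrow> 0"
proof (rule Lim_null_comparison)
  show "eventually (\<lambda>j. norm (of_nat (m (N j)) / of_nat (N j) * w j - of_real (1 - slope) * freq t)
      \<le> norm (w j - freq t) + norm (freq t) * (1 / real (N j))) sequentially"
    using N_pos by eventually_elim (use phase_bound in auto)
  have "(\<lambda>j. norm (w j - freq t) + norm (freq t) * (1 / real (N j))) \<longlonglongrightarrow>
      norm (freq t - freq t) + norm (freq t) * 0"
    by (intro tendsto_intros w_lim[unfolded assms] inverse_N)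
  then show "(\<lambda>j. norm (w j - freq t) + norm (freq t) * (1 / real (N j))) \<longlonglongrightarrow> 0" by simp
qed

lemma phase_small:
  assumes "w0 = freq t"
  shows "eventually (\<lambda>j. norm (of_nat (m (N j)) / of_nat (N j) * w j - of_real (1 - slope) * freq t)
           \<le> 1/8) sequentially"
  using order_tendstoD(2)[OF tendsto_norm[OF phase_null[OF assms]], of "1/8"]
  by (auto elim: eventually_mono)

text \<open>The exponential of the defect is 1, so it lies in the discrete set of multiples of
  \<open>2 * pi * \<i>\<close>; as it tends to 0, it is eventually 0.\<close>

lemma eventually_defect_zero:
  assumes "w0 = freq t" "even ((q - p) * t)"
  shows "eventually (\<lambda>j. defect t (N j) (w j) = 0) sequentially"
proof -
  let ?y = "\<lambda>j. of_nat (m (N j)) / of_nat (N j) * w j - of_real (1 - slope) * freq t"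
  have "(\<lambda>j. clog_err (?y j)) \<longlonglongrightarrow> 0"
  proof (rule Lim_null_comparison)
    show "eventually (\<lambda>j. norm (clog_err (?y j)) \<le> 3 * norm (?y j) ^ 2) sequentially"
      using phase_small[OF assms(1)] by eventually_elim (rule clog_err_bound)
    have "(\<lambda>j. 3 * norm (?y j) ^ 2) \<longlonglongrightarrow> 3 * norm (0 :: complex) ^ 2"
      by (intro tendsto_intros phase_null assms(1))
    then show "(\<lambda>j. 3 * norm (?y j) ^ 2) \<longlonglongrightarrow> 0" by simp
  qed
  then have "(\<lambda>j. 2 * (w j - freq t) + of_nat (k (N j)) * clog_err (w j / of_nat (N j)) +
      clog_err (?y j)) \<longlonglongrightarrow> 2 * (freq t - freq t) + 0 + 0"
    by (intro tendsto_intros w_lim[unfolded assms(1)] scaled_clog_err_null)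
  then have "(\<lambda>j. norm (2 * (w j - freq t) + of_nat (k (N j)) * clog_err (w j / of_nat (N j)) +
      clog_err (?y j))) \<longlonglongrightarrow> 0"
    by (intro tendsto_norm_zero) simp
  then have "eventually (\<lambda>j. norm (2 * (w j - freq t) + of_nat (k (N j)) * clog_err (w j / of_nat (N j)) +
      clog_err (?y j)) < 1) sequentially"
    by (rule order_tendstoD) simp
  then show ?thesis using N_pos w_over_N_small phase_small[OF assms(1)] root
  proof eventually_elim
    case (elim j)
    have "exp (defect t (N j) (w j)) = 1"
      using exp_defect[OF assms(2) elim(2-4)] elim(5) by simp
    then obtain n :: int where n: "Re (defect t (N j) (w j)) = 0"
        "Im (defect t (N j) (w j)) = of_int (2 * n) * pi"
      by (auto simp: exp_eq_1)
    have "norm (defect t (N j) (w j)) < 1"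
      using elim(1) by (simp only: defect_expand[OF elim(2)])
    then have "\<bar>of_int (2 * n) * pi\<bar> < 1"
      using abs_Im_le_cmod[of "defect t (N j) (w j)"] unfolding n(2) by linarith
    moreover have "\<bar>of_int (2 * n) * pi\<bar> \<ge> 1" if "n \<noteq> 0"
    proof -
      have "1 * 1 \<le> \<bar>real_of_int (2 * n)\<bar> * pi"
        using that pi_ge_two by (intro mult_mono) linarith+
      then show ?thesis by (simp add: abs_mult)
    qed
    ultimately have "n = 0" by linarith
    with n show ?case by (simp add: complex_eq_iff)
  qed
qed

text \<open>Near 0 the linear term \<open>2 * w\<close> dominates the quadratic errors, so no root
  other than \<open>x = 1\<close> belongs to the frequency 0.\<close>

lemma eventually_zero:
  assumes "w0 = 0"
  shows "eventually (\<lambda>j. w j = 0) sequentially"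
proof -
  have w0: "w0 = freq 0" using assms by (simp add: freq_def)
  have "eventually (\<lambda>j. norm (w j) < 1/8) sequentially"
    using tendsto_norm_zero[OF w_lim[unfolded assms]] by (rule order_tendstoD) simp
  moreover have "eventually (\<lambda>j. defect 0 (N j) (w j) = 0) sequentially"
    using eventually_defect_zero[OF w0] by simp
  ultimately have "eventually (\<lambda>j. defect 0 (N j) (w j) = 0 \<and> norm (w j) < 1/8) sequentially"
    by (rule eventually_conj[rotated])
  with N_pos w_over_N_small phase_small[OF w0]
  show ?thesis
  proof eventually_elim
    case (elim j)
    let ?y = "of_nat (m (N j)) / of_nat (N j) * w j - of_real (1 - slope) * freq 0"
    have "norm ?y \<le> norm (w j)"
      using phase_bound[OF elim(1), of "w j" 0] by (simp add: freq_def)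
    then have "norm ?y ^ 2 \<le> norm (w j) ^ 2" by (intro power_mono) auto
    then have 1: "norm (clog_err ?y) \<le> 3 * norm (w j) ^ 2"
      using clog_err_bound[OF elim(3)] by linarith
    have "3 * norm (w j) ^ 2 / N j \<le> 3 * norm (w j) ^ 2 / 1"
      using elim(1) by (intro divide_left_mono) auto
    then have 2: "norm (of_nat (k (N j)) * clog_err (w j / of_nat (N j))) \<le> 3 * norm (w j) ^ 2"
      using scaled_clog_err_bound[OF elim(1,2)] by linarith
    have w: "w j - freq 0 = w j" by (simp add: freq_def)
    have "2 * w j + of_nat (k (N j)) * clog_err (w j / of_nat (N j)) + clog_err ?y = 0"
      using elim(4) unfolding defect_expand[OF elim(1)] w by (rule conjunct1)
    then have "2 * w j = - (of_nat (k (N j)) * clog_err (w j / of_nat (N j)) + clog_err ?y)"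
      by (simp only: eq_neg_iff_add_eq_0 add.assoc)
    then have "norm (2 * w j) \<le> 3 * norm (w j) ^ 2 + 3 * norm (w j) ^ 2"
      using norm_triangle_mono[OF 2 1] by (simp only: norm_minus_cancel)
    also have "\<dots> = (6 * norm (w j)) * norm (w j)" by (simp add: power2_eq_square)
    also have "\<dots> \<le> 1 * norm (w j)"
      using elim(4) by (intro mult_right_mono) auto
    finally have "norm (w j) \<le> 0" by (simp add: norm_mult)
    then show ?case by simp
  qed
qed

section \<open>Second-order asymptotics\<close>

text \<open>The term \<open>- z^2\<close> of \<open>clog_err\<close>, with \<open>z = w / N\<close>,
  contributes \<open>- (k / N) * w^2\<close> after scaling; the cubic remainder contributes
  \<open>O(1 / N)\<close>.\<close>

lemma second_order_limit:
  "(\<lambda>j. of_nat (N j) * (of_nat (k (N j)) * clog_err (w j / of_nat (N j)))) \<longlonglongrightarrow> - (of_real slope * w0\<^sup>2)"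
proof -
  let ?z = "\<lambda>j. w j / of_nat (N j)"
  let ?r = "\<lambda>j. complex_of_real (real (k (N j)) / real (N j))"
  have "(\<lambda>j. of_nat (N j) * (of_nat (k (N j)) * (clog_err (?z j) + ?z j ^ 2))) \<longlonglongrightarrow> 0"
  proof (rule Lim_null_comparison)
    show "eventually (\<lambda>j. norm (of_nat (N j) * (of_nat (k (N j)) * (clog_err (?z j) + ?z j ^ 2)))
        \<le> 15 * norm (w j) ^ 3 * (1 / real (N j))) sequentially"
      using N_pos w_over_N_small
    proof eventually_elim
      case (elim j)
      have "norm (of_nat (N j) * (of_nat (k (N j)) * (clog_err (?z j) + ?z j ^ 2)))
          \<le> real (N j) * (real (N j) * (15 * norm (?z j) ^ 3))"
        unfolding norm_mult clog_err_def using clog_taylor[OF elim(2)] k_le[of "N j"]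
        by (intro mult_mono) auto
      also have "\<dots> = 15 * norm (w j) ^ 3 * (1 / real (N j))"
        using elim(1) by (simp add: norm_divide power_divide power3_eq_cube)
      finally show ?case .
    qed
    have "(\<lambda>j. 15 * norm (w j) ^ 3 * (1 / real (N j))) \<longlonglongrightarrow> 15 * norm w0 ^ 3 * 0"
      by (intro tendsto_intros w_lim inverse_N)
    then show "(\<lambda>j. 15 * norm (w j) ^ 3 * (1 / real (N j))) \<longlonglongrightarrow> 0" by simp
  qed
  then have "(\<lambda>j. of_nat (N j) * (of_nat (k (N j)) * (clog_err (?z j) + ?z j ^ 2)) - ?r j * w j ^ 2)
      \<longlonglongrightarrow> 0 - of_real slope * w0 ^ 2"
    by (intro tendsto_intros ratio_kN w_lim)
  moreover have "eventually (\<lambda>j. of_nat (N j) * (of_nat (k (N j)) * (clog_err (?z j) + ?z j ^ 2)) - ?r j * w j ^ 2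
      = of_nat (N j) * (of_nat (k (N j)) * clog_err (?z j))) sequentially"
    using N_pos
  proof eventually_elim
    case (elim j)
    have "of_nat (N j) * (of_nat (k (N j)) * ?z j ^ 2) = ?r j * w j ^ 2"
      using elim by (simp add: power2_eq_square)
    then show ?case by (simp only: distrib_left) simp
  qed
  ultimately show ?thesis by (simp add: tendsto_cong)
qed

lemma displacement_limit:
  assumes w0: "w0 = freq t" and t: "even ((q - p) * t)"
  shows "(\<lambda>j. of_nat (N j) * (w j - freq t)) \<longlonglongrightarrow> - of_real (pi\<^sup>2 * p * q * t\<^sup>2 / 2)"
proof -
  define y u A B where "y j = of_nat (m (N j)) / of_nat (N j) * w j - of_real (1 - slope) * freq t"
    and "u j = of_nat (N j) * (w j - freq t)"
    and "A j = of_nat (N j) * (of_nat (k (N j)) * clog_err (w j / of_nat (N j)))"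
    and "B j = of_nat (N j) * clog_err (y j)" for j
  have A: "A \<longlonglongrightarrow> - (of_real slope * (freq t)\<^sup>2)"
    using second_order_limit unfolding w0 A_def .
  have eq: "eventually (\<lambda>j. 2 * u j = - A j - B j) sequentially"
    using eventually_defect_zero[OF w0 t] N_pos
  proof eventually_elim
    case (elim j)
    have "2 * u j + A j + B j = of_nat (N j) * defect t (N j) (w j)"
      unfolding defect_expand[OF elim(2)] u_def A_def B_def y_def
      by (simp only: distrib_left mult.left_commute)
    then have "2 * u j + A j + B j = 0" using elim(1) by simp
    moreover have "a = - b - c" if "a + b + c = 0" for a b c :: complex
      using that by (simp add: eq_neg_iff_add_eq_0 algebra_simps)
    ultimately show ?case by blast
  qed
  have "B \<longlonglongrightarrow> 0"
  proof (rule Lim_null_comparison)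
    \<comment> \<open>Boundedness of \<open>u\<close> is not yet known. As
      \<open>3 * norm (y j) < 1\<close>, \<open>B\<close> is at most
      \<open>norm (u j) + norm (freq t)\<close>; inserting this into \<open>2 * u = - A - B\<close>
      bounds \<open>u\<close> in terms of the convergent \<open>A\<close>, after which the factor
      \<open>y \<longlonglongrightarrow> 0\<close> gives the limit.\<close>
    show "eventually (\<lambda>j. norm (B j) \<le> 3 * norm (y j) * (norm (A j) + 2 * norm (freq t))) sequentially"
      using eq N_pos phase_small[OF w0]
    proof eventually_elim
      case (elim j)
      have y8: "norm (y j) \<le> 1/8" using elim(3) by (simp only: y_def)
      have "real (N j) * norm (y j) \<le> real (N j) * (norm (w j - freq t) + norm (freq t) / N j)"
        unfolding y_def by (intro mult_left_mono phase_bound elim) auto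
      also have "\<dots> = norm (u j) + norm (freq t)"
        using elim(2) by (simp add: u_def norm_mult distrib_left)
      finally have Ny: "real (N j) * norm (y j) \<le> norm (u j) + norm (freq t)" .
      have "norm (B j) \<le> real (N j) * (3 * norm (y j) ^ 2)"
        unfolding B_def norm_mult norm_of_nat by (intro mult_left_mono clog_err_bound y8) auto
      also have "\<dots> = 3 * norm (y j) * (real (N j) * norm (y j))"
        by (simp add: power2_eq_square)
      also have "\<dots> \<le> 3 * norm (y j) * (norm (u j) + norm (freq t))"
        by (intro mult_left_mono Ny) auto
      finally have B1: "norm (B j) \<le> 3 * norm (y j) * (norm (u j) + norm (freq t))" .
      also have "\<dots> \<le> 1 * (norm (u j) + norm (freq t))"
        using y8 by (intro mult_right_mono) auto
      finally have "norm (B j) \<le> norm (u j) + norm (freq t)" by simp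
      moreover have "2 * norm (u j) \<le> norm (A j) + norm (B j)"
        using norm_triangle_ineq4[of "- A j" "B j"] unfolding elim(1)[symmetric]
        by (simp add: norm_mult)
      ultimately have "norm (u j) + norm (freq t) \<le> norm (A j) + 2 * norm (freq t)" by linarith
      then have "3 * norm (y j) * (norm (u j) + norm (freq t))
          \<le> 3 * norm (y j) * (norm (A j) + 2 * norm (freq t))"
        by (intro mult_left_mono) auto
      with B1 show ?case by linarith
    qed
    have "(\<lambda>j. 3 * norm (y j) * (norm (A j) + 2 * norm (freq t))) \<longlonglongrightarrow>
        3 * norm (0 :: complex) * (norm (- (of_real slope * (freq t)\<^sup>2)) + 2 * norm (freq t))"
      unfolding y_def by (intro tendsto_intros phase_null[OF w0] A)
    then show "(\<lambda>j. 3 * norm (y j) * (norm (A j) + 2 * norm (freq t))) \<longlonglongrightarrow> 0" by simp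
  qed
  then have "(\<lambda>j. (- A j - B j) / 2) \<longlonglongrightarrow> (- (- (of_real slope * (freq t)\<^sup>2)) - 0) / 2"
    by (intro tendsto_intros A) auto
  moreover have "eventually (\<lambda>j. (- A j - B j) / 2 = u j) sequentially"
    using eq by eventually_elim (metis nonzero_mult_div_cancel_left zero_neq_numeral)
  ultimately have "u \<longlonglongrightarrow> (- (- (of_real slope * (freq t)\<^sup>2)) - 0) / 2"
    by (rule Lim_transform_eventually)
  moreover have "slope * (pi * q * t)\<^sup>2 = pi\<^sup>2 * (slope * q) * q * t\<^sup>2"
    by (simp add: power2_eq_square)
  then have "(- (- (of_real slope * (freq t)\<^sup>2)) - 0) / 2 = - complex_of_real (pi\<^sup>2 * p * q * t\<^sup>2 / 2)"
    unfolding slope freq_def by (simp add: power_mult_distrib flip: of_real_mult of_real_power)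
  ultimately show ?thesis by (simp add: u_def[abs_def])
qed

text \<open>As \<open>freq t\<close> is imaginary, \<open>N * Re w\<close> has the limit of the
  displacement. For \<open>x < 1\<close> the bounds
  \<open>- x / (1 - x) \<le> 1 - exp x \<le> - x\<close> transfer it to the modulus.\<close>

lemma modulus_limit:
  assumes w0: "w0 = freq t" and t: "even ((q - p) * t)"
  shows "(\<lambda>j. (real (N j))\<^sup>2 * (1 - norm (exp (w j / of_nat (N j))))) \<longlonglongrightarrow> pi\<^sup>2 * p * q * t\<^sup>2 / 2"
proof -
  let ?c = "pi\<^sup>2 * p * q * t\<^sup>2 / 2"
  define x where "x j = Re (w j) / real (N j)" for j
  have norm_x: "norm (exp (w j / of_nat (N j))) = exp (x j)" for j
    by (simp add: x_def)
  have "(\<lambda>j. Re (of_nat (N j) * (w j - freq t))) \<longlonglongrightarrow> Re (- of_real ?c)"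
    by (intro tendsto_Re displacement_limit assms)
  then have "(\<lambda>j. real (N j) * Re (w j)) \<longlonglongrightarrow> - ?c" by (simp add: freq_def)
  moreover have "eventually (\<lambda>j. real (N j) * Re (w j) = (real (N j))\<^sup>2 * x j) sequentially"
    using N_pos by eventually_elim (simp add: x_def power2_eq_square)
  ultimately have Nx: "(\<lambda>j. (real (N j))\<^sup>2 * x j) \<longlonglongrightarrow> - ?c"
    by (rule Lim_transform_eventually)
  have "(\<lambda>j. Re (w j) * (1 / real (N j))) \<longlonglongrightarrow> Re w0 * 0"
    by (intro tendsto_intros w_lim inverse_N)
  then have x0: "x \<longlonglongrightarrow> 0" by (simp add: x_def[abs_def])
  then have x1: "eventually (\<lambda>j. x j < 1) sequentially" by (rule order_tendstoD) simp
  show ?thesis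
  proof (rule tendsto_sandwich)
    show "eventually (\<lambda>j. - ((real (N j))\<^sup>2 * x j) / (1 - x j)
        \<le> (real (N j))\<^sup>2 * (1 - norm (exp (w j / of_nat (N j))))) sequentially"
      using x1
    proof eventually_elim
      case (elim j)
      have "1 + - x j \<le> exp (- x j)" by (rule exp_ge_add_one_self)
      then have "(1 - x j) * exp (x j) \<le> 1"
        using mult_right_mono[of "1 - x j" "exp (- x j)" "exp (x j)"] by (simp add: exp_minus)
      then have "- x j / (1 - x j) \<le> 1 - exp (x j)"
        using elim by (simp add: field_simps)
      then have "(real (N j))\<^sup>2 * (- x j / (1 - x j)) \<le> (real (N j))\<^sup>2 * (1 - exp (x j))"
        by (intro mult_left_mono) auto
      then show ?case unfolding norm_x by simp
    qed
    show "eventually (\<lambda>j. (real (N j))\<^sup>2 * (1 - norm (exp (w j / of_nat (N j))))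
        \<le> - ((real (N j))\<^sup>2 * x j)) sequentially"
    proof (rule always_eventually, rule allI)
      fix j
      have "(real (N j))\<^sup>2 * (1 - exp (x j)) \<le> (real (N j))\<^sup>2 * (- x j)"
        using exp_ge_add_one_self[of "x j"] by (intro mult_left_mono) (linarith, simp)
      then show "(real (N j))\<^sup>2 * (1 - norm (exp (w j / of_nat (N j)))) \<le> - ((real (N j))\<^sup>2 * x j)"
        unfolding norm_x by simp
    qed
    have "(\<lambda>j. - ((real (N j))\<^sup>2 * x j) / (1 - x j)) \<longlonglongrightarrow> - (- ?c) / (1 - 0)"
      by (intro tendsto_intros Nx x0) auto
    then show "(\<lambda>j. - ((real (N j))\<^sup>2 * x j) / (1 - x j)) \<longlonglongrightarrow> ?c" by simp
    show "(\<lambda>j. - ((real (N j))\<^sup>2 * x j)) \<longlonglongrightarrow> ?c"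
      using tendsto_minus[OF Nx] by simp
  qed
qed

end

subsection \<open>The spectral gap\<close>

text \<open>If \<open>norm y > 1\<close> then \<open>norm (2 * y - 1) > 1\<close>. Applied to
  \<open>x\<close> and to \<open>x ^ m\<close>, this would make the product exceed 1 in
  modulus.\<close>

lemma norm_le_1_if_char_eqn:
  assumes "char_eqn k m x" "k > 0" "m > 0"
  shows "norm x \<le> 1"
proof (rule ccontr)
  assume "\<not> norm x \<le> 1"
  then have x: "norm x > 1" by simp
  have gt: "norm (2 * y - 1) > 1" if "norm y > 1" for y :: complex
    using norm_triangle_ineq2[of "2 * y" 1] that by (simp add: norm_mult)
  have "norm ((2 * x - 1) ^ k) > 1"
    unfolding norm_power using gt[OF x] assms(2) by (rule one_less_power)
  moreover have "norm (x ^ m) > 1"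
    unfolding norm_power using x assms(3) by (rule one_less_power)
  then have "norm (2 * x ^ m - 1) > 1" by (rule gt)
  ultimately have "norm ((2 * x - 1) ^ k * (2 * x ^ m - 1)) > 1"
    unfolding norm_mult by (rule less_1_mult)
  with assms(1) show False by simp
qed

lemma abs_ln_le:
  assumes "1/2 \<le> r" "r \<le> 1"
  shows "\<bar>ln r\<bar> \<le> 2 * (1 - r :: real)"
proof -
  have r: "r > 0" using assms by linarith
  have "ln (1 / r) \<le> 1 / r - 1" using r by (intro ln_le_minus_one) simp
  also have "1 / r - 1 = (1 / r) * (1 - r)" using r by (simp add: field_simps)
  also have "\<dots> \<le> 2 * (1 - r)"
    using assms r by (intro mult_right_mono) (auto simp: field_simps)
  finally have "- ln r \<le> 2 * (1 - r)" using r by (simp add: ln_div)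
  moreover have "ln r \<le> 0" using assms r by simp
  ultimately show ?thesis by simp
qed

context rational_slope begin

text \<open>A modulus close to 1 keeps \<open>2 * x ^ m - 1\<close> from being small, so the other
  factor cannot be large. Spread over \<open>k \<ge> slope / 2 * n\<close> powers, this leaves
  \<open>norm (2 * x - 1) ^ 2 - 1 = O(1 / n^2)\<close>, which the parallelogram identity turns into
  a bound on \<open>x - 1\<close>.\<close>

lemma near_1_if_char_eqn:
  assumes root: "char_eqn (k n) (m n) x" and C: "C \<ge> 0" "1 - norm x \<le> C / (real n)\<^sup>2"
    and n: "n > 0" "8 * C \<le> real n" "slope / 2 * n \<le> k n"
  shows "norm (x - 1) ^ 2 \<le> (2 * C + 8 * C / slope) / (real n)\<^sup>2"
proof -
  define a b s where "a = C / (real n)\<^sup>2" and "b = C / real n" and "s = norm (2 * x - 1) ^ 2 - 1"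
  have b: "0 \<le> b" "b \<le> 1/8" using C n by (auto simp: b_def field_simps)
  have nab: "real n * a = b" by (simp add: a_def b_def power2_eq_square)
  have a0: "0 \<le> a" using C by (simp add: a_def)
  have "1 * a \<le> real n * a" using n a0 by (intro mult_right_mono) auto
  then have a: "a \<le> 1/8" using b nab by linarith
  have r: "1 - a \<le> norm x" using C(2) by (simp add: a_def)
  then have "(1 - a) ^ 2 \<le> norm x ^ 2" using a by (intro power_mono) auto
  moreover have "(1 - a) ^ 2 \<ge> 1 - 2 * a" by (simp add: power2_eq_square algebra_simps)
  ultimately have s: "s \<ge> 2 * norm (x - 1) ^ 2 - 4 * a"
    unfolding s_def norm_two_times_minus_1 by linarith
  have "1 + real (m n) * - a \<le> (1 + - a) ^ m n"
    using a by (intro Bernoulli_inequality) simp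
  also have "\<dots> \<le> norm x ^ m n" using r a by (intro power_mono) auto
  finally have "norm (x ^ m n) \<ge> 1 - real (m n) * a" by (simp add: norm_power)
  moreover have "real (m n) * a \<le> real n * a" using a0 by (intro mult_right_mono) (auto simp: m_def)
  ultimately have "norm (x ^ m n) \<ge> 1 - b" using nab by linarith
  then have "norm (2 * x ^ m n - 1) \<ge> 1 - 2 * b"
    using norm_triangle_ineq2[of "2 * x ^ m n" 1] by (simp add: norm_mult)
  then have "(1 - 2 * b) ^ 2 \<le> norm (2 * x ^ m n - 1) ^ 2"
    using b by (intro power_mono) auto
  moreover have "(1 - 2 * b) ^ 2 \<ge> 1 - 4 * b" by (simp add: power2_eq_square algebra_simps)
  ultimately have m: "1 - 4 * b \<le> norm (2 * x ^ m n - 1) ^ 2" by linarith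
  have "norm (2 * x - 1) ^ k n * norm (2 * x ^ m n - 1) = 1"
    using arg_cong[OF root, of norm] by (simp only: norm_mult norm_power norm_one)
  then have "(norm (2 * x - 1) ^ k n * norm (2 * x ^ m n - 1)) ^ 2 = 1" by simp
  then have prod: "(norm (2 * x - 1) ^ 2) ^ k n * norm (2 * x ^ m n - 1) ^ 2 = 1"
    by (simp only: power_mult_distrib power_mult[symmetric] mult.commute)
  have "1 + real (k n) * s \<le> (1 + s) ^ k n"
    by (intro Bernoulli_inequality) (simp add: s_def)
  then have "(1 + real (k n) * s) * (1 - 4 * b) \<le> (1 + s) ^ k n * (1 - 4 * b)"
    using b by (intro mult_right_mono) auto
  also have "\<dots> \<le> (1 + s) ^ k n * norm (2 * x ^ m n - 1) ^ 2"
    using m by (intro mult_left_mono) (auto simp: s_def)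
  also have "\<dots> = 1" using prod by (simp add: s_def)
  finally have le1: "(1 + real (k n) * s) * (1 - 4 * b) \<le> 1" .
  \<comment> \<open>For \<open>0 \<le> b \<le> 1/8\<close> this yields
    \<open>1 / (1 - 4 * b) \<le> 1 + 8 * b\<close>.\<close>
  have "32 * (b * b) \<le> 4 * b" using b mult_right_mono[of b "1/8" b] by simp
  then have "1 \<le> (1 + 8 * b) * (1 - 4 * b)" by (simp add: algebra_simps)
  with le1 have "(1 + real (k n) * s) * (1 - 4 * b) \<le> (1 + 8 * b) * (1 - 4 * b)" by linarith
  then have ks: "real (k n) * s \<le> 8 * b" using b by (simp add: mult_le_cancel_right)
  have "slope / 2 * n * s \<le> 8 * b"
  proof (cases "s \<ge> 0")
    case True
    then have "slope / 2 * n * s \<le> real (k n) * s" using n(3) by (intro mult_right_mono)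
    with ks show ?thesis by linarith
  next
    case False
    then have "slope / 2 * n * s \<le> 0" using slope by (intro mult_nonneg_nonpos) auto
    with b show ?thesis by linarith
  qed
  then have "s \<le> 8 * b / (slope / 2 * n)"
    using slope n by (simp add: pos_le_divide_eq mult.commute)
  also have "\<dots> = 16 * C / slope / (real n)\<^sup>2" by (simp add: b_def power2_eq_square)
  finally have "2 * norm (x - 1) ^ 2 \<le> 16 * C / slope / (real n)\<^sup>2 + 4 * (C / (real n)\<^sup>2)"
    using s by (simp add: a_def)
  then show ?thesis by (simp add: add_divide_distrib)
qed

text \<open>The compactness half of the argument: \<open>w\<close> is bounded because
  \<open>x - 1 = O(1 / N)\<close>, and its real part tends to 0 because
  \<open>1 - norm x = O(1 / N^2)\<close>. Every limit point is therefore some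
  \<open>freq t\<close>.\<close>

lemma limit_of_slow_eigenvalues:
  assumes N: "filterlim N at_top sequentially"
    and root: "eventually (\<lambda>j. char_eqn (k (N j)) (m (N j)) (x j)) sequentially"
    and ne1: "\<And>j. x j \<noteq> 1"
    and slow: "eventually (\<lambda>j. (real (N j))\<^sup>2 * (1 - norm (x j)) \<le> C) sequentially"
  obtains r t where "strict_mono r" "t \<noteq> 0" "even ((q - p) * t)"
    "(\<lambda>j. (real (N (r j)))\<^sup>2 * (1 - norm (x (r j)))) \<longlonglongrightarrow> pi\<^sup>2 * p * q * t\<^sup>2 / 2"
proof -
  \<comment> \<open>\<open>C\<close> may be negative, whereas the localisation near 1 asks for a
    nonnegative constant. \<open>K\<close> is then the constant in
    \<open>norm (x - 1) \<le> K / N\<close>.\<close>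
  define D where "D = max C 0"
  define K where "K = sqrt (2 * D + 8 * D / slope)"
  define w where "w j = of_nat (N j) * Ln (x j)" for j
  have large: "eventually (\<lambda>j. real (N j) \<ge> c) sequentially" for c
    using filterlim_compose[OF filterlim_real_sequentially N] by (simp add: filterlim_at_top)
  have N_pos: "eventually (\<lambda>j. N j > 0) sequentially"
    using large[of 1] by eventually_elim auto
  have ev: "eventually (\<lambda>j. exp (w j / of_nat (N j)) = x j \<and> norm (w j) \<le> 2 * K
      \<and> \<bar>Re (w j)\<bar> \<le> 2 * D * (1 / real (N j))) sequentially"
    using root slow eventually_compose_filterlim[OF eventually_k N] N_pos
      large[of "8 * D"] large[of "2 * K + 1"]
  proof eventually_elim
    case (elim j)
    have D: "D \<ge> 0" "C \<le> D" by (auto simp: D_def)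
    have K0: "K \<ge> 0" using D slope by (simp add: K_def)
    have gap: "1 - norm (x j) \<le> D / (real (N j))\<^sup>2"
      using elim(2,4) D by (simp add: field_simps)
    have "norm (x j - 1) ^ 2 \<le> (K / real (N j)) ^ 2"
      using near_1_if_char_eqn[OF elim(1) D(1) gap elim(4,5)] elim(3) D slope
      by (simp add: K_def power_divide)
    then have x1: "norm (x j - 1) \<le> K / real (N j)"
      by (rule power2_le_imp_le) (use K0 in auto)
    also have "\<dots> < 1/2" using elim(4,6) by (simp add: field_simps)
    finally have x2: "norm (x j - 1) < 1/2" .
    then have x0: "x j \<noteq> 0" by auto
    have "norm (Ln (1 + (x j - 1))) \<le> 2 * norm (x j - 1)"
      using x2 by (rule norm_Ln_le)
    then have "norm (Ln (x j)) \<le> 2 * (K / real (N j))" using x1 by simp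
    then have "norm (w j) \<le> real (N j) * (2 * (K / real (N j)))"
      unfolding w_def norm_mult norm_of_nat by (intro mult_left_mono) auto
    then have 1: "norm (w j) \<le> 2 * K" using elim(4) by simp
    have le1: "norm (x j) \<le> 1"
      using norm_le_1_if_char_eqn[OF elim(1)] elim(3) by (auto simp: m_def)
    have "norm (x j) \<ge> 1/2"
      using norm_triangle_ineq2[of 1 "1 - x j"] x2 by (simp add: norm_minus_commute)
    then have "\<bar>ln (norm (x j))\<bar> \<le> 2 * (1 - norm (x j))"
      using le1 by (rule abs_ln_le)
    then have "\<bar>Re (Ln (x j))\<bar> \<le> 2 * (D / (real (N j))\<^sup>2)" using gap x0 by simp
    then have "real (N j) * \<bar>Re (Ln (x j))\<bar> \<le> real (N j) * (2 * (D / (real (N j))\<^sup>2))"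
      by (intro mult_left_mono) auto
    also have "\<dots> = 2 * D * (1 / real (N j))" by (simp add: power2_eq_square)
    finally have "\<bar>Re (w j)\<bar> \<le> 2 * D * (1 / real (N j))" by (simp add: w_def abs_mult)
    moreover have "exp (w j / of_nat (N j)) = x j" using x0 elim(4) by (simp add: w_def)
    ultimately show ?case using 1 by simp
  qed
  have "Bseq w"
    by (rule BfunI[of _ "2 * K"]) (use ev in \<open>auto elim: eventually_mono\<close>)
  then obtain w0 r where r: "strict_mono (r :: nat \<Rightarrow> nat)" and lim: "(w \<circ> r) \<longlonglongrightarrow> w0"
    using bounded_imp_convergent_subsequence[of w] by (auto simp: Bseq_eq_bounded)
  have Nr: "filterlim (\<lambda>j. N (r j)) at_top sequentially"
    using filterlim_compose[OF N filterlim_subseq[OF r]] .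
  have "(\<lambda>j. Re (w j)) \<longlonglongrightarrow> 0"
  proof (rule Lim_null_comparison)
    show "eventually (\<lambda>j. norm (Re (w j)) \<le> 2 * D * (1 / real (N j))) sequentially"
      using ev by (auto elim: eventually_mono)
    have "(\<lambda>j. 1 / real (N j)) \<longlonglongrightarrow> 0"
      using filterlim_compose[OF lim_1_over_n N] by simp
    from tendsto_mult_right_zero[OF this, of "2 * D"]
    show "(\<lambda>j. 2 * D * (1 / real (N j))) \<longlonglongrightarrow> 0" by simp
  qed
  from LIMSEQ_subseq_LIMSEQ[OF this r] have "(\<lambda>j. Re ((w \<circ> r) j)) \<longlonglongrightarrow> 0"
    by (simp add: o_def)
  then have Re0: "Re w0 = 0"
    using tendsto_Re[OF lim] LIMSEQ_unique by blast
  have ex: "eventually (\<lambda>j. exp ((w \<circ> r) j / of_nat (N (r j))) = x (r j)) sequentially"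
    using eventually_subseq[OF r ev] by (auto elim: eventually_mono)
  interpret root_sequence p q "\<lambda>j. N (r j)" "w \<circ> r" w0
  proof
    show "eventually (\<lambda>j. char_eqn (k (N (r j))) (m (N (r j)))
        (exp ((w \<circ> r) j / of_nat (N (r j))))) sequentially"
      using ex eventually_subseq[OF r root] by eventually_elim simp
  qed (use Nr lim in auto)
  obtain t where t: "even ((q - p) * t)" "w0 = freq t"
    using limit_is_freq[OF Re0] by blast
  have "t \<noteq> 0"
  proof
    assume "t = 0"
    then have "w0 = 0" using t by (simp add: freq_def)
    from eventually_zero[OF this] ex have "eventually (\<lambda>j. False) sequentially"
      by eventually_elim (use ne1 in auto)
    then show False by simp
  qed
  moreover have "(\<lambda>j. (real (N (r j)))\<^sup>2 * (1 - norm (x (r j)))) \<longlonglongrightarrow> pi\<^sup>2 * p * q * t\<^sup>2 / 2"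
  proof (rule Lim_transform_eventually[OF modulus_limit[OF t(2,1)]])
    show "eventually (\<lambda>j. (real (N (r j)))\<^sup>2 * (1 - norm (exp ((w \<circ> r) j / of_nat (N (r j))))) =
        (real (N (r j)))\<^sup>2 * (1 - norm (x (r j)))) sequentially"
      using ex by eventually_elim (simp only:)
  qed
  ultimately show thesis using that r t(1) by blast
qed

section \<open>Two-sided limit of the scaled gap\<close>

definition nonunit_roots :: "nat \<Rightarrow> complex set" where
  "nonunit_roots n = {x. char_eqn (k n) (m n) x \<and> x \<noteq> 1}"

lemma spectral_gap_eq:
  assumes "1 \<le> k n" "k n < n"
  shows "spectral_gap n (k n) = 1 - Max (cmod ` nonunit_roots n)" "finite (nonunit_roots n)"
proof -
  have *: "nonunit_roots n = set_mset (proots (char_poly (single_card_matrix n (k n))) - {#1#})"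
    unfolding nonunit_eigenvalues_single_card[OF assms] nonunit_roots_def m_def ..
  show "spectral_gap n (k n) = 1 - Max (cmod ` nonunit_roots n)" "finite (nonunit_roots n)"
    unfolding spectral_gap_def * by simp_all
qed

text \<open>The root built near \<open>freq t\<close> bounds the gap from above. For the lower
  bound, infinitely many \<open>n\<close> with a smaller scaled gap would give a subsequence
  converging to a value for some admissible \<open>s \<noteq> 0\<close>, and \<open>t\<close> has
  the least admissible modulus.\<close>

lemma spectral_gap_limit:
  fixes t :: int
  defines "t \<equiv> (if even (q - p) then 1 else 2)"
  shows "(\<lambda>n. (real n)\<^sup>2 * spectral_gap n (k n)) \<longlonglongrightarrow> pi\<^sup>2 * p * q * t\<^sup>2 / 2"
proof -
  let ?c = "pi\<^sup>2 * p * q * t\<^sup>2 / 2"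
  have t: "even ((q - p) * t)" "t \<noteq> 0" by (auto simp: t_def)
  obtain w where w: "w \<longlonglongrightarrow> freq t"
    and wroot: "eventually (\<lambda>n. char_eqn (k n) (m n) (exp (w n / of_nat n))) sequentially"
    using roots_tendsto_freq[OF t(1)] by blast
  interpret root_sequence p q "\<lambda>n. n" w "freq t"
    by unfold_locales (use w wroot in \<open>auto simp: filterlim_ident\<close>)
  have "freq t \<noteq> 0" using t(2) slope(3) by (simp add: freq_def)
  then have "eventually (\<lambda>n. w n \<noteq> 0) sequentially" using w tendsto_imp_eventually_ne by blast
  \<comment> \<open>The imaginary part of \<open>w n / n\<close> is below \<open>pi\<close> in
    modulus, so \<open>Ln\<close> recovers it from its exponential, and
    \<open>w n \<noteq> 0\<close> excludes the eigenvalue 1.\<close>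
  with w_over_N_small N_pos have ne: "eventually (\<lambda>n. exp (w n / of_nat n) \<noteq> 1) sequentially"
  proof eventually_elim
    case (elim n)
    have "\<bar>Im (w n / of_nat n)\<bar> < pi"
      using abs_Im_le_cmod[of "w n / of_nat n"] elim(1) pi_ge_two by linarith
    then have "Ln (exp (w n / of_nat n)) = w n / of_nat n" by (intro Ln_exp) linarith+
    then show ?case using elim(2,3) by force
  qed
  have upper: "eventually (\<lambda>n. (real n)\<^sup>2 * spectral_gap n (k n)
      \<le> (real n)\<^sup>2 * (1 - norm (exp (w n / of_nat n)))) sequentially"
    using eventually_k wroot ne
  proof eventually_elim
    case (elim n)
    then have "exp (w n / of_nat n) \<in> nonunit_roots n" by (simp add: nonunit_roots_def)
    then have "norm (exp (w n / of_nat n)) \<le> Max (cmod ` nonunit_roots n)"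
      using spectral_gap_eq(2)[of n] elim(1) by (intro Max_ge finite_imageI imageI) auto
    then show ?case
      using spectral_gap_eq(1)[of n] elim(1) by (intro mult_left_mono) auto
  qed
  have attained: "eventually (\<lambda>n. \<exists>x. char_eqn (k n) (m n) x \<and> x \<noteq> 1 \<and>
      spectral_gap n (k n) = 1 - norm x) sequentially"
    using eventually_k wroot ne
  proof eventually_elim
    case (elim n)
    then have "nonunit_roots n \<noteq> {}" by (auto simp: nonunit_roots_def)
    then have "Max (cmod ` nonunit_roots n) \<in> cmod ` nonunit_roots n"
      using spectral_gap_eq(2)[of n] elim(1) by (intro Max_in) auto
    then show ?case using spectral_gap_eq(1)[of n] elim(1) by (auto simp: nonunit_roots_def)
  qed
  show ?thesis
  proof (rule order_tendstoI)
    fix a assume "?c < a"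
    with modulus_limit[OF refl t(1)]
    have "eventually (\<lambda>n. (real n)\<^sup>2 * (1 - norm (exp (w n / of_nat n))) < a) sequentially"
      by (rule order_tendstoD)
    with upper show "eventually (\<lambda>n. (real n)\<^sup>2 * spectral_gap n (k n) < a) sequentially"
      by eventually_elim linarith
  next
    fix a assume a: "a < ?c"
    show "eventually (\<lambda>n. a < (real n)\<^sup>2 * spectral_gap n (k n)) sequentially"
    proof (rule ccontr)
      \<comment> \<open>The implication is chosen so that each failure of \<open>?P\<close> supplies
        an eigenvalue attaining the gap together with the bound by \<open>a\<close>.\<close>
      let ?P = "\<lambda>n. (\<exists>x. char_eqn (k n) (m n) x \<and> x \<noteq> 1 \<and> spectral_gap n (k n) = 1 - norm x)
          \<longrightarrow> a < (real n)\<^sup>2 * spectral_gap n (k n)"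
      assume "\<not> ?thesis"
      moreover have "eventually (\<lambda>n. a < (real n)\<^sup>2 * spectral_gap n (k n)) sequentially"
        if "eventually ?P sequentially"
        using that attained by eventually_elim simp
      ultimately have "\<not> eventually ?P sequentially" by blast
      then obtain N :: "nat \<Rightarrow> nat" where N: "strict_mono N" and "\<And>j. \<not> ?P (N j)"
        using not_eventually_sequentiallyD by blast
      then have "\<forall>j. \<exists>x. char_eqn (k (N j)) (m (N j)) x \<and> x \<noteq> 1 \<and>
          (real (N j))\<^sup>2 * (1 - norm x) \<le> a"
        by (metis not_less)
      then obtain x where x: "\<And>j. char_eqn (k (N j)) (m (N j)) (x j)" "\<And>j. x j \<noteq> 1"
          "\<And>j. (real (N j))\<^sup>2 * (1 - norm (x j)) \<le> a"
        by metis
      obtain r s where r: "strict_mono r" and s: "s \<noteq> 0" "even ((q - p) * s)"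
        and lim: "(\<lambda>j. (real (N (r j)))\<^sup>2 * (1 - norm (x (r j)))) \<longlonglongrightarrow> pi\<^sup>2 * p * q * s\<^sup>2 / 2"
        by (rule limit_of_slow_eigenvalues[of N x a]) (use filterlim_subseq[OF N] x in auto)
      have "\<bar>t\<bar> \<le> \<bar>s\<bar>"
      proof (cases "even (q - p)")
        case False
        then have "even s" using s(2) by simp
        with s(1) show ?thesis by (auto simp: t_def elim!: evenE)
      qed (use s(1) in \<open>simp add: t_def\<close>)
      then have "t\<^sup>2 \<le> s\<^sup>2" by (simp add: abs_le_square_iff)
      then have ts: "(real_of_int t)\<^sup>2 \<le> (real_of_int s)\<^sup>2"
        by (simp only: flip: of_int_power of_int_le_iff)
      \<comment> \<open>Positivity of \<open>p * q\<close> is read off from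
        \<open>slope * q^2\<close>, which covers negative \<open>p\<close> and \<open>q\<close> as
        well.\<close>
      have "real_of_int p * q = slope * (real_of_int q)\<^sup>2"
        using slope(4) by (simp add: power2_eq_square mult.assoc[symmetric])
      then have "0 \<le> pi\<^sup>2 * (real_of_int p * q)" using slope by simp
      from mult_left_mono[OF ts this] have "?c \<le> pi\<^sup>2 * p * q * s\<^sup>2 / 2" by (simp add: mult.assoc)
      moreover have "pi\<^sup>2 * p * q * s\<^sup>2 / 2 \<le> a"
        by (rule LIMSEQ_le_const2[OF lim]) (use x(3) in auto)
      ultimately show False using a by linarith
    qed
  qed
qed

end

theorem theorem1:
  fixes p q :: int
  assumes "0 < real_of_int p / real_of_int q"
    and "real_of_int p / real_of_int q < 1"
    and "gcd p q = 1"
  shows "(\<lambda>n::nat. spectral_gap n (nat \<lfloor>real_of_int p / real_of_int q * real n\<rfloor>))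
     \<sim>[at_top]
     (\<lambda>n::nat. pi ^ 2 * real_of_int p * real_of_int q / (2 * real n ^ 2) *
        (if [p = q] (mod 2) then 1 else 4))"
proof -
  interpret rational_slope p q by unfold_locales (use assms in auto)
  define t :: int where "t = (if even (q - p) then 1 else 2)"
  define c where "c = pi\<^sup>2 * p * q * t\<^sup>2 / 2"
  have k: "nat \<lfloor>real_of_int p / real_of_int q * real n\<rfloor> = k n" for n
    by (simp add: k_def slope_def)
  have "[p = q] (mod 2) \<longleftrightarrow> even (q - p)"
    by (auto simp: cong_iff_dvd_diff)
  \<comment> \<open>The case factor 1 or 4 is \<open>t^2\<close>.\<close>
  then have c_eq: "pi ^ 2 * real_of_int p * real_of_int q / (2 * real n ^ 2) *
        (if [p = q] (mod 2) then 1 else 4) = c / (real n)\<^sup>2" for n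
    by (simp add: c_def t_def)
  have "p \<noteq> 0" using slope by auto
  then have c0: "c \<noteq> 0" using slope(3) by (simp add: c_def t_def)
  have "(\<lambda>n. (real n)\<^sup>2 * spectral_gap n (k n)) \<longlonglongrightarrow> c"
    unfolding c_def t_def by (rule spectral_gap_limit)
  then have "(\<lambda>n. (real n)\<^sup>2 * spectral_gap n (k n) / c) \<longlonglongrightarrow> c / c"
    by (intro tendsto_intros c0)
  then have "(\<lambda>n. spectral_gap n (k n) / (c / (real n)\<^sup>2)) \<longlonglongrightarrow> 1"
    using c0 by (simp add: mult.commute)
  then show ?thesis
    unfolding k c_eq by (rule asymp_equivI')
qed

end
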